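(* Let $M$ be a closed piecewise locally symmetric manifold of dimension $\geq 3$. If $\mathrm{Out}(\pi_1(M))$ is infinite, then $M$ does not admit any Riemannian metric such that $\mathrm{Out}(\pi_1(M))$ can be realized as a group of isometries; that is, there is no Riemannian metric $g$ on $M$ admitting a homomorphism $\rho\colon\mathrm{Out}(\pi_1(M))\to\mathrm{Isom}(M,g)$ whose composition with the natural homomorphism $\mathrm{Isom}(M,g)\to\mathrm{Out}(\pi_1(M))$ (action on $\pi_1$) is the identity.
   Context: Locally symmetric manifolds. A "locally symmetric manifold" $X$ means a connected, noncompact, complete, finite-volume, locally symmetric, nonpositively curved Riemannian manifold of noncompact type: $X=\Gamma\backslash G/K$ with $G$ a semisimple Lie group, $K\subset G$ a maximal compact subgroup, and $\Gamma\cong\pi_1(X)$ a torsion-free lattice in $G$. Compactification. $\overline{X}$ denotes the following compact smooth manifold with corners whose interior is diffeomorphic to $X$. (i) If $X$ is arithmetic, $\overline X$ is the Borel–Serre compactification of $X$ (the quotient by $\Gamma$ of the Borel–Serre partial compactification of $G/K$; its boundary strata correspond to $\Gamma$-conjugacy classes of proper rational parabolic subgroups of $G$). (ii) If $X$ is of $\mathbb{R}$-rank 1 and not arithmetic, $\overline X$ is the compact manifold with boundary obtained by deleting $(b,\infty)\times S$ from each cusp $[0,\infty)\times S$, where cross sections are quotients of horospheres and $b$ is large. (iii) If $X$ is reducible, i.e. finitely covered by a product $Y=\prod_j Y_j$ of noncompact irreducible locally symmetric manifolds, $\overline X$ is the quotient of $\prod_j\overline{Y_j}$ by the (extended) covering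 group action. Mirrors. For a smooth $n$-manifold with corners (modelled on $[0,\infty)^n$), let $c(x)$ be the number of zero coordinates of $x$ in a chart; a stratum of codimension $k$ is a connected component of $c^{-1}(k)$, and a closed stratum is the closure of a stratum. It is nice if every $x$ with $c(x)=2$ lies in exactly two closed codimension-1 strata; $\overline X$ is nice. The mirrors of $\overline X$ are its closed codimension-1 strata $\{X_s\}_{s\in S}$. For $T\subseteq S$ put $X_T=\bigcap_{s\in T}X_s$; for $x\in\overline X$ put $S(x)=\{s\in S: x\in X_s\}$. The nerve $N(\overline X)$ is the simplicial complex with vertex set $S$ in which a nonempty $T\subseteq S$ is a simplex iff $X_T\neq\emptyset$. Reflection group trick. Let $(W,S)$ be a Coxeter system; for $T\subseteq S$ let $W_T$ be the subgroup generated by $T$. Its nerve $L(W,S)$ is the simplicial complex with vertex set $S$ whose simplices are the nonempty $T\subseteq S$ with $W_T$ finite. Define $U(W,\overline X)=(W\times\overline X)/\!\sim$, where $(h,x)\sim(g,y)$ iff $x=y$ and $h^{-1}g\in W_{S(x)}$; $W$ acts on it by left multiplication on the first factor. Piecewise locally symmetric manifolds. Let $X$ be a locally symmetric manifold and $(W,S)$ a Coxeter system, with $S$ the set of mirrors of $\overline X$, such that $L(W,S)=N(\overline X)$. Then $U(W,\overline X)$ is a smooth manifold. A piecewise locally symmetric manifold is a quotient $M=U(W,\overline X)/W'$ by a torsion-free subgroup $W'\le W$. *)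

theory Defs
  imports
    "HOL-Analysis.Analysis"
    "HOL-Algebra.Bij"
    "HOL-Algebra.Solvable_Groups"
    "HOL-Algebra.Multiplicative_Group"
    "Jordan_Normal_Form.Matrix"
begin

section \<open>Quotient topologies\<close>

definition quotient_topology :: "'a topology \<Rightarrow> ('a \<Rightarrow> 'b) \<Rightarrow> 'b topology" where
  "quotient_topology X f =
     topology (\<lambda>V. V \<subseteq> f ` topspace X \<and> openin X {x \<in> topspace X. f x \<in> V})"

lemma openin_quotient_topology:
  "openin (quotient_topology X f) V \<longleftrightarrow>
     V \<subseteq> f ` topspace X \<and> openin X {x \<in> topspace X. f x \<in> V}"
proof -
  have "istopology (\<lambda>V. V \<subseteq> f ` topspace X \<and> openin X {x \<in> topspace X. f x \<in> V})"
    unfolding istopology_def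
  proof (intro conjI allI impI)
    fix S T
    assume S: "S \<subseteq> f ` topspace X \<and> openin X {x \<in> topspace X. f x \<in> S}"
      and T: "T \<subseteq> f ` topspace X \<and> openin X {x \<in> topspace X. f x \<in> T}"
    have "{x \<in> topspace X. f x \<in> S \<inter> T}
        = {x \<in> topspace X. f x \<in> S} \<inter> {x \<in> topspace X. f x \<in> T}" by auto
    then show "openin X {x \<in> topspace X. f x \<in> S \<inter> T}" using S T by auto
    show "S \<inter> T \<subseteq> f ` topspace X" using S by auto
  next
    fix K
    assume K: "\<forall>V\<in>K. V \<subseteq> f ` topspace X \<and> openin X {x \<in> topspace X. f x \<in> V}"
    have "{x \<in> topspace X. f x \<in> \<Union>K} = (\<Union>V\<in>K. {x \<in> topspace X. f x \<in> V})" by auto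
    then show "openin X {x \<in> topspace X. f x \<in> \<Union>K}" using K by auto
    show "\<Union>K \<subseteq> f ` topspace X" using K by auto
  qed
  then show ?thesis
    by (simp add: quotient_topology_def topology_inverse')
qed

section \<open>Smooth manifolds, possibly with corners\<close>

text \<open>Euclidean \<open>n\<close>-space is the set of sequences supported on \<open>{..<n}\<close>,
  as in \<^const>\<open>Euclidean_space\<close>.\<close>

definition eucl :: "nat \<Rightarrow> (nat \<Rightarrow> real) set" where
  "eucl n = {x. \<forall>i\<ge>n. x i = 0}"

definition orthant :: "nat \<Rightarrow> (nat \<Rightarrow> real) set" where
  "orthant n = {x \<in> eucl n. \<forall>i<n. 0 \<le> x i}"

text \<open>A function is of class \<open>C\<^sup>\<infinity>\<close> if it lies in a family of continuous functions
  closed under taking partial derivatives.\<close>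

definition smooth_open :: "nat \<Rightarrow> (nat \<Rightarrow> real) set \<Rightarrow> ((nat \<Rightarrow> real) \<Rightarrow> real) \<Rightarrow> bool" where
  "smooth_open n U f \<longleftrightarrow>
     openin (top_of_set (eucl n)) U \<and>
     (\<exists>F. f \<in> F \<and> (\<forall>h\<in>F. continuous_on U h \<and>
        (\<forall>i<n. \<exists>h'\<in>F. \<forall>x\<in>U. ((\<lambda>t. h (x(i := t))) has_real_derivative h' x) (at (x i)))))"

definition smooth_real :: "nat \<Rightarrow> (nat \<Rightarrow> real) set \<Rightarrow> ((nat \<Rightarrow> real) \<Rightarrow> real) \<Rightarrow> bool" where
  "smooth_real n A f \<longleftrightarrow>
     (\<forall>x\<in>A. \<exists>U f'. x \<in> U \<and> smooth_open n U f' \<and> (\<forall>y\<in>A \<inter> U. f' y = f y))"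

definition smooth_on ::
    "nat \<Rightarrow> (nat \<Rightarrow> real) set \<Rightarrow> nat \<Rightarrow> ((nat \<Rightarrow> real) \<Rightarrow> nat \<Rightarrow> real) \<Rightarrow> bool" where
  "smooth_on n A m f \<longleftrightarrow> (\<forall>j<m. smooth_real n A (\<lambda>x. f x j))"

type_synonym 'a chart = "'a set \<times> ('a \<Rightarrow> nat \<Rightarrow> real)"

record 'a mfd =
  mdim :: nat
  mtop :: "'a topology"
  charts :: "'a chart set"

definition loc_rep :: "'a chart \<Rightarrow> 'b chart \<Rightarrow> ('a \<Rightarrow> 'b) \<Rightarrow> (nat \<Rightarrow> real) \<Rightarrow> nat \<Rightarrow> real" where
  "loc_rep c d f = (\<lambda>z. snd d (f (the_inv_into (fst c) (snd c) z)))"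

definition chart_in :: "(nat \<Rightarrow> real) set \<Rightarrow> 'a topology \<Rightarrow> 'a chart \<Rightarrow> bool" where
  "chart_in H X c \<longleftrightarrow>
     openin X (fst c) \<and> openin (top_of_set H) (snd c ` fst c) \<and>
     homeomorphic_map (subtopology X (fst c)) (top_of_set (snd c ` fst c)) (snd c)"

definition modelled_on :: "(nat \<Rightarrow> (nat \<Rightarrow> real) set) \<Rightarrow> 'a mfd \<Rightarrow> bool" where
  "modelled_on H M \<longleftrightarrow>
     Hausdorff_space (mtop M) \<and> second_countable (mtop M) \<and>
     (\<forall>c\<in>charts M. chart_in (H (mdim M)) (mtop M) c) \<and>
     topspace (mtop M) = (\<Union>c\<in>charts M. fst c) \<and>
     (\<forall>c\<in>charts M. \<forall>d\<in>charts M.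
        smooth_on (mdim M) (snd c ` (fst c \<inter> fst d)) (mdim M) (loc_rep c d (\<lambda>x. x)))"

abbreviation smooth_manifold :: "'a mfd \<Rightarrow> bool" where
  "smooth_manifold \<equiv> modelled_on eucl"

abbreviation manifold_with_corners :: "'a mfd \<Rightarrow> bool" where
  "manifold_with_corners \<equiv> modelled_on orthant"

definition closed_manifold :: "'a mfd \<Rightarrow> bool" where
  "closed_manifold M \<longleftrightarrow> smooth_manifold M \<and> compact_space (mtop M)"

definition smooth_map :: "'a mfd \<Rightarrow> 'a set \<Rightarrow> 'b mfd \<Rightarrow> ('a \<Rightarrow> 'b) \<Rightarrow> bool" where
  "smooth_map M D N f \<longleftrightarrow>
     continuous_map (subtopology (mtop M) D) (mtop N) f \<and>
     (\<forall>c\<in>charts M. \<forall>d\<in>charts N.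
        smooth_on (mdim M) (snd c ` {x \<in> fst c \<inter> D. f x \<in> fst d}) (mdim N) (loc_rep c d f))"

definition diffeomorphism :: "'a mfd \<Rightarrow> 'b mfd \<Rightarrow> ('a \<Rightarrow> 'b) \<Rightarrow> bool" where
  "diffeomorphism M N f \<longleftrightarrow>
     bij_betw f (topspace (mtop M)) (topspace (mtop N)) \<and>
     smooth_map M (topspace (mtop M)) N f \<and>
     smooth_map N (topspace (mtop N)) M (the_inv_into (topspace (mtop M)) f)"

definition quotient_mfd :: "'a mfd \<Rightarrow> ('a \<times> 'a) set \<Rightarrow> 'a set mfd" where
  "quotient_mfd M R =
     \<lparr>mdim = mdim M,
      mtop = quotient_topology (mtop M) (\<lambda>x. R `` {x}),
      charts = {((\<lambda>x. R `` {x}) ` V, \<lambda>c. snd d (the_inv_into V (\<lambda>x. R `` {x}) c)) | d V.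
        d \<in> charts M \<and> V \<subseteq> fst d \<and> openin (mtop M) V \<and> inj_on (\<lambda>x. R `` {x}) V}\<rparr>"

definition concat_coords :: "nat \<Rightarrow> (nat \<Rightarrow> nat) \<Rightarrow> (nat \<Rightarrow> nat \<Rightarrow> real) \<Rightarrow> nat \<Rightarrow> real" where
  "concat_coords k d v = (\<lambda>i. if i < (\<Sum>j<k. d j)
     then let j = (LEAST j. i < (\<Sum>l\<le>j. d l)) in v j (i - (\<Sum>l<j. d l))
     else 0)"

definition product_mfd :: "nat \<Rightarrow> (nat \<Rightarrow> 'a mfd) \<Rightarrow> (nat \<Rightarrow> 'a) mfd" where
  "product_mfd k Q =
     \<lparr>mdim = (\<Sum>j<k. mdim (Q j)),
      mtop = product_topology (\<lambda>j. mtop (Q j)) {..<k},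
      charts = {(\<Pi>\<^sub>E j\<in>{..<k}. fst (c j),
                 \<lambda>x. concat_coords k (\<lambda>j. mdim (Q j)) (\<lambda>j. snd (c j) (x j))) | c.
        \<forall>j<k. c j \<in> charts (Q j)}\<rparr>"

text \<open>The structure for which a family of maps \<open>\<mu>\<close>, defined on subsets \<open>S\<close> of Euclidean spaces,
  consists of submersions: the topology is final, and a chart is a homeomorphism onto an open
  subset of the orthant that is smooth along the \<open>\<mu>\<close> and whose inverse locally lifts smoothly
  through some \<open>\<mu>\<close>.\<close>

type_synonym 'p param = "nat \<times> (nat \<Rightarrow> real) set \<times> ((nat \<Rightarrow> real) \<Rightarrow> 'p)"

definition param_topology :: "'p param set \<Rightarrow> 'p topology" where
  "param_topology F = topology (\<lambda>V. V \<subseteq> (\<Union>(m, S, \<mu>)\<in>F. \<mu> ` S) \<and>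
     (\<forall>(m, S, \<mu>)\<in>F. openin (top_of_set S) {z \<in> S. \<mu> z \<in> V}))"

lemma openin_param_topology:
  "openin (param_topology F) V \<longleftrightarrow> V \<subseteq> (\<Union>(m, S, \<mu>)\<in>F. \<mu> ` S) \<and>
     (\<forall>(m, S, \<mu>)\<in>F. openin (top_of_set S) {z \<in> S. \<mu> z \<in> V})"
proof -
  have pre: "{z \<in> S. \<mu> z \<in> \<Union>K} = (\<Union>V\<in>K. {z \<in> S. \<mu> z \<in> V})"
    "{z \<in> S. \<mu> z \<in> A \<inter> B} = {z \<in> S. \<mu> z \<in> A} \<inter> {z \<in> S. \<mu> z \<in> B}"
    for S :: "(nat \<Rightarrow> real) set" and \<mu> :: "(nat \<Rightarrow> real) \<Rightarrow> 'a" and K A B by auto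
  have "istopology (\<lambda>V. V \<subseteq> (\<Union>(m, S, \<mu>)\<in>F. \<mu> ` S) \<and>
     (\<forall>(m, S, \<mu>)\<in>F. openin (top_of_set S) {z \<in> S. \<mu> z \<in> V}))"
    unfolding istopology_def pre case_prod_unfold
    by (intro conjI allI impI ballI openin_Int openin_Union)
      (auto simp: le_infI1 Sup_least)
  then show ?thesis
    by (simp only: param_topology_def topology_inverse')
qed

definition param_mfd :: "nat \<Rightarrow> 'p param set \<Rightarrow> 'p mfd" where
  "param_mfd n F =
     \<lparr>mdim = n,
      mtop = param_topology F,
      charts = {(V, \<psi>) | V \<psi>.
        openin (param_topology F) V \<and> inj_on \<psi> V \<and> openin (top_of_set (orthant n)) (\<psi> ` V) \<and>
        (\<forall>(m, S, \<mu>)\<in>F. smooth_on m {z \<in> S. \<mu> z \<in> V} n (\<lambda>z. \<psi> (\<mu> z))) \<and>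
        (\<forall>x\<in>V. \<exists>(m, S, \<mu>)\<in>F. \<exists>B \<sigma>.
           \<psi> x \<in> B \<and> B \<subseteq> \<psi> ` V \<and> openin (top_of_set (orthant n)) B \<and>
           smooth_on n B m \<sigma> \<and> \<sigma> ` B \<subseteq> S \<and>
           (\<forall>y\<in>B. \<mu> (\<sigma> y) = the_inv_into V \<psi> y))}\<rparr>"

definition corner_depth :: "'a mfd \<Rightarrow> 'a \<Rightarrow> nat" where
  "corner_depth Q x =
     (let c = (SOME c. c \<in> charts Q \<and> x \<in> fst c) in card {i. i < mdim Q \<and> snd c x i = 0})"

definition strata :: "'a mfd \<Rightarrow> nat \<Rightarrow> 'a set set" where
  "strata Q k =
     connected_components_of (subtopology (mtop Q) {x \<in> topspace (mtop Q). corner_depth Q x = k})"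

definition mirrors :: "'a mfd \<Rightarrow> 'a set set" where
  "mirrors Q = (\<lambda>Z. mtop Q closure_of Z) ` strata Q 1"

section \<open>Matrix groups\<close>

definition GLn :: "nat \<Rightarrow> 'a::field mat monoid" where
  "GLn N = units_of (ring_mat TYPE('a) N ())"

abbreviation minv :: "nat \<Rightarrow> 'a::field mat \<Rightarrow> 'a mat" where
  "minv N A \<equiv> inv\<^bsub>GLn N\<^esub> A"

definition mconj :: "nat \<Rightarrow> 'a::field mat \<Rightarrow> 'a mat \<Rightarrow> 'a mat" where
  "mconj N A X = A * X * minv N A"

abbreviation subgrp :: "nat \<Rightarrow> 'a::field mat set \<Rightarrow> 'a mat monoid" where
  "subgrp N H \<equiv> (GLn N)\<lparr>carrier := H\<rparr>"

definition finite_index :: "nat \<Rightarrow> 'a::field mat set \<Rightarrow> 'a mat set \<Rightarrow> bool" where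
  "finite_index N H' H \<longleftrightarrow> subgroup H' (subgrp N H) \<and> finite (rcosets\<^bsub>subgrp N H\<^esub> H')"

definition commensurable :: "nat \<Rightarrow> 'a::field mat set \<Rightarrow> 'a mat set \<Rightarrow> bool" where
  "commensurable N H H' \<longleftrightarrow> finite_index N (H \<inter> H') H \<and> finite_index N (H \<inter> H') H'"

definition torsion_free :: "('a, 'b) monoid_scheme \<Rightarrow> 'a set \<Rightarrow> bool" where
  "torsion_free G H \<longleftrightarrow> (\<forall>x\<in>H. \<forall>n::nat. 0 < n \<longrightarrow> x [^]\<^bsub>G\<^esub> n = \<one>\<^bsub>G\<^esub> \<longrightarrow> x = \<one>\<^bsub>G\<^esub>)"

definition vec_of :: "nat \<Rightarrow> real mat \<Rightarrow> nat \<Rightarrow> real" where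
  "vec_of N A = (\<lambda>k. if k < N * N then A $$ (k div N, k mod N) else 0)"

definition mat_of :: "nat \<Rightarrow> (nat \<Rightarrow> real) \<Rightarrow> real mat" where
  "mat_of N z = Matrix.mat N N (\<lambda>(i, j). z (i * N + j))"

definition mat_top :: "nat \<Rightarrow> real mat topology" where
  "mat_top N = pullback_topology (carrier_mat N N) (vec_of N) euclidean"

definition identity_component :: "nat \<Rightarrow> real mat set \<Rightarrow> real mat set" where
  "identity_component N H = connected_component_of_set (subtopology (mat_top N) H) (1\<^sub>m N)"

text \<open>For a closed subgroup of \<open>GL(N, \<real>)\<close> this is its Lie algebra.\<close>

definition lie_algebra :: "nat \<Rightarrow> real mat set \<Rightarrow> real mat set" where
  "lie_algebra N H = {X \<in> carrier_mat N N. \<exists>c. range c \<subseteq> H \<and> c 0 = 1\<^sub>m N \<and>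
     (\<forall>i<N. \<forall>j<N. ((\<lambda>t. c t $$ (i, j)) has_real_derivative X $$ (i, j)) (at 0))}"

definition lie_bracket :: "real mat \<Rightarrow> real mat \<Rightarrow> real mat" where
  "lie_bracket X Y = X * Y - Y * X"

definition lie_ideal :: "nat \<Rightarrow> real mat set \<Rightarrow> real mat set \<Rightarrow> bool" where
  "lie_ideal N L I \<longleftrightarrow> I \<subseteq> L \<and> 0\<^sub>m N N \<in> I \<and>
     (\<forall>X\<in>I. \<forall>Y\<in>I. X + Y \<in> I) \<and> (\<forall>X\<in>I. \<forall>r. r \<cdot>\<^sub>m X \<in> I) \<and>
     (\<forall>X\<in>L. \<forall>Y\<in>I. lie_bracket X Y \<in> I)"

definition semisimple_lie_algebra :: "nat \<Rightarrow> real mat set \<Rightarrow> bool" where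
  "semisimple_lie_algebra N L \<longleftrightarrow>
     (\<forall>I. lie_ideal N L I \<and> (\<forall>X\<in>I. \<forall>Y\<in>I. lie_bracket X Y = 0\<^sub>m N N) \<longrightarrow> I = {0\<^sub>m N N})"

definition semisimple_lie_group :: "nat \<Rightarrow> real mat set \<Rightarrow> bool" where
  "semisimple_lie_group N G \<longleftrightarrow>
     subgroup G (GLn N) \<and> closedin (subtopology (mat_top N) (carrier (GLn N))) G \<and>
     semisimple_lie_algebra N (lie_algebra N G) \<and> finite_index N (identity_component N G) G"

definition maximal_compact :: "nat \<Rightarrow> real mat set \<Rightarrow> real mat set \<Rightarrow> bool" where
  "maximal_compact N G K \<longleftrightarrow>
     subgroup K (subgrp N G) \<and> compactin (mat_top N) K \<and>
     (\<forall>K'. subgroup K' (subgrp N G) \<and> compactin (mat_top N) K' \<and> K \<subseteq> K' \<longrightarrow> K' = K)"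

definition cartan_involution ::
    "nat \<Rightarrow> real mat set \<Rightarrow> real mat set \<Rightarrow> (real mat \<Rightarrow> real mat) \<Rightarrow> bool" where
  "cartan_involution N G K \<theta> \<longleftrightarrow>
     \<theta> \<in> iso (subgrp N G) (subgrp N G) \<and>
     continuous_map (subtopology (mat_top N) G) (subtopology (mat_top N) G) \<theta> \<and>
     (\<forall>g\<in>G. \<theta> (\<theta> g) = g) \<and> {g \<in> G. \<theta> g = g} = K"

definition coset_space :: "nat \<Rightarrow> real mat set \<Rightarrow> real mat set \<Rightarrow> real mat set topology" where
  "coset_space N G \<Gamma> =
     quotient_topology (subtopology (mat_top N) G) (\<lambda>g. \<Gamma> #>\<^bsub>subgrp N G\<^esub> g)"

definition lattice_in :: "nat \<Rightarrow> real mat set \<Rightarrow> real mat set \<Rightarrow> bool" where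
  "lattice_in N G \<Gamma> \<longleftrightarrow>
     subgroup \<Gamma> (subgrp N G) \<and>
     subtopology (mat_top N) \<Gamma> = discrete_topology \<Gamma> \<and>
     (\<exists>\<nu>. space \<nu> = topspace (coset_space N G \<Gamma>) \<and>
          sets \<nu> = sigma_sets (space \<nu>) {U. openin (coset_space N G \<Gamma>) U} \<and>
          0 < emeasure \<nu> (space \<nu>) \<and> emeasure \<nu> (space \<nu>) < \<infinity> \<and>
          (\<forall>g\<in>G. \<forall>A\<in>sets \<nu>.
             emeasure \<nu> ((\<lambda>c. c #>\<^bsub>subgrp N G\<^esub> g) ` A) = emeasure \<nu> A))"

section \<open>Locally symmetric manifolds\<close>

text \<open>A datum stands for \<open>\<Gamma>\<backslash>G/K\<close>, where \<open>G \<le> GL(deg, \<real>)\<close>. Replacing a semisimple group by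
  its image in the (linear) isometry group of \<open>G/K\<close> does not change \<open>\<Gamma>\<backslash>G/K\<close>, because a
  torsion-free discrete group meets the compact kernel trivially; so it is no restriction to
  consider linear groups. Points of \<open>G/K\<close> are the cosets \<open>gK\<close>, and \<open>h\<close> acts by \<open>(`) ((*) h)\<close>.\<close>

record datum =
  deg :: nat
  grp :: "real mat set"
  cpt :: "real mat set"
  lat :: "real mat set"

definition coset :: "datum \<Rightarrow> real mat \<Rightarrow> real mat set" where
  "coset D g = (*) g ` cpt D"

definition symmetric_space :: "datum \<Rightarrow> real mat set topology" where
  "symmetric_space D = quotient_topology (subtopology (mat_top (deg D)) (grp D)) (coset D)"

abbreviation symm_points :: "datum \<Rightarrow> real mat set set" where
  "symm_points D \<equiv> topspace (symmetric_space D)"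

definition double_coset :: "datum \<Rightarrow> real mat \<Rightarrow> real mat set" where
  "double_coset D g = {\<gamma> * g * k | \<gamma> k. \<gamma> \<in> lat D \<and> k \<in> cpt D}"

definition quotient_space :: "datum \<Rightarrow> real mat set topology" where
  "quotient_space D = quotient_topology (subtopology (mat_top (deg D)) (grp D)) (double_coset D)"

definition locsym_datum :: "datum \<Rightarrow> bool" where
  "locsym_datum D \<longleftrightarrow>
     semisimple_lie_group (deg D) (grp D) \<and> maximal_compact (deg D) (grp D) (cpt D) \<and>
     lattice_in (deg D) (grp D) (lat D) \<and> torsion_free (GLn (deg D)) (lat D)"

definition locally_symmetric :: "datum \<Rightarrow> bool" where
  "locally_symmetric D \<longleftrightarrow> locsym_datum D \<and> \<not> compact_space (quotient_space D)"

subsection \<open>Isometries and coverings\<close>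

definition prod_points :: "nat \<Rightarrow> (nat \<Rightarrow> datum) \<Rightarrow> (nat \<Rightarrow> real mat set) set" where
  "prod_points k E = (\<Pi>\<^sub>E j\<in>{..<k}. symm_points (E j))"

definition prod_act ::
    "nat \<Rightarrow> (nat \<Rightarrow> real mat) \<Rightarrow> (nat \<Rightarrow> real mat set) \<Rightarrow> nat \<Rightarrow> real mat set" where
  "prod_act k h x = (\<lambda>j\<in>{..<k}. (*) (h j) ` x j)"

definition corresponds ::
    "nat \<Rightarrow> (nat \<Rightarrow> datum) \<Rightarrow> ((nat \<Rightarrow> real mat set) \<Rightarrow> real mat set) \<Rightarrow>
     (nat \<Rightarrow> real mat) \<Rightarrow> real mat \<Rightarrow> bool" where
  "corresponds k E F h g \<longleftrightarrow> (\<forall>x\<in>prod_points k E. F (prod_act k h x) = (*) g ` F x)"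

definition intertwines ::
    "nat \<Rightarrow> (nat \<Rightarrow> datum) \<Rightarrow> ((nat \<Rightarrow> real mat set) \<Rightarrow> real mat set) \<Rightarrow>
     (nat \<Rightarrow> real mat set) \<Rightarrow> real mat set \<Rightarrow> bool" where
  "intertwines k E F H H' \<longleftrightarrow>
     (\<forall>h \<in> (\<Pi>\<^sub>E j\<in>{..<k}. H j). \<exists>g\<in>H'. corresponds k E F h g) \<and>
     (\<forall>g\<in>H'. \<exists>h \<in> (\<Pi>\<^sub>E j\<in>{..<k}. H j). corresponds k E F h g)"

text \<open>The homeomorphisms between symmetric spaces of noncompact type that carry the
  transformations coming from the identity components to one another are the isometries,
  up to rescaling the metric on each irreducible factor.\<close>

definition affine_iso ::
    "nat \<Rightarrow> (nat \<Rightarrow> datum) \<Rightarrow> datum \<Rightarrow> ((nat \<Rightarrow> real mat set) \<Rightarrow> real mat set) \<Rightarrow> bool" where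
  "affine_iso k E D F \<longleftrightarrow>
     homeomorphic_map (product_topology (\<lambda>j. symmetric_space (E j)) {..<k}) (symmetric_space D) F \<and>
     intertwines k E F (\<lambda>j. identity_component (deg (E j)) (grp (E j)))
       (identity_component (deg D) (grp D))"

definition product_lattice ::
    "nat \<Rightarrow> (nat \<Rightarrow> datum) \<Rightarrow> datum \<Rightarrow> ((nat \<Rightarrow> real mat set) \<Rightarrow> real mat set) \<Rightarrow> real mat set" where
  "product_lattice k E D F =
     {\<gamma> \<in> lat D. \<exists>h \<in> (\<Pi>\<^sub>E j\<in>{..<k}. lat (E j)). corresponds k E F h \<gamma>}"

definition finite_cover ::
    "nat \<Rightarrow> (nat \<Rightarrow> datum) \<Rightarrow> datum \<Rightarrow> ((nat \<Rightarrow> real mat set) \<Rightarrow> real mat set) \<Rightarrow> bool" where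
  "finite_cover k E D F \<longleftrightarrow>
     affine_iso k E D F \<and>
     (\<forall>h \<in> (\<Pi>\<^sub>E j\<in>{..<k}. lat (E j)). \<exists>\<gamma>\<in>lat D. corresponds k E F h \<gamma>) \<and>
     finite_index (deg D) (product_lattice k E D F) (lat D)"

definition virtually_splits :: "datum \<Rightarrow> bool" where
  "virtually_splits D \<longleftrightarrow>
     (\<exists>E F. (\<forall>j<2. locsym_datum (E j) \<and> grp (E j) \<noteq> cpt (E j)) \<and> finite_cover 2 E D F)"

section \<open>Algebraic groups over the rationals\<close>

text \<open>An algebraic group is represented by its group of complex points in \<open>GL(N, \<complex>)\<close>.
  \<open>poly_funs N C\<close> are the polynomials in the matrix entries with coefficients in \<open>C\<close>.\<close>

inductive_set poly_funs :: "nat \<Rightarrow> complex set \<Rightarrow> (complex mat \<Rightarrow> complex) set"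
  for N :: nat and C :: "complex set" where
  const: "c \<in> C \<Longrightarrow> (\<lambda>A. c) \<in> poly_funs N C"
| entry: "i < N \<Longrightarrow> j < N \<Longrightarrow> (\<lambda>A. A $$ (i, j)) \<in> poly_funs N C"
| add: "p \<in> poly_funs N C \<Longrightarrow> q \<in> poly_funs N C \<Longrightarrow> (\<lambda>A. p A + q A) \<in> poly_funs N C"
| mult: "p \<in> poly_funs N C \<Longrightarrow> q \<in> poly_funs N C \<Longrightarrow> (\<lambda>A. p A * q A) \<in> poly_funs N C"

definition algebraic_group :: "nat \<Rightarrow> complex set \<Rightarrow> complex mat set \<Rightarrow> bool" where
  "algebraic_group N C H \<longleftrightarrow>
     subgroup H (GLn N) \<and>
     (\<exists>I \<subseteq> poly_funs N C. H = {A \<in> carrier (GLn N). \<forall>p\<in>I. p A = 0})"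

definition zariski_component :: "nat \<Rightarrow> complex mat set \<Rightarrow> complex mat set" where
  "zariski_component N H = \<Inter>{H'. algebraic_group N UNIV H' \<and> finite_index N H' H}"

definition zariski_connected :: "nat \<Rightarrow> complex mat set \<Rightarrow> bool" where
  "zariski_connected N H \<longleftrightarrow> zariski_component N H = H"

definition borel_subgroup :: "nat \<Rightarrow> complex mat set \<Rightarrow> complex mat set \<Rightarrow> bool" where
  "borel_subgroup N H B \<longleftrightarrow>
     (let solv = (\<lambda>B. algebraic_group N UNIV B \<and> zariski_connected N B \<and>
                      solvable (subgrp N B) \<and> B \<subseteq> H)
      in solv B \<and> (\<forall>B'. solv B' \<and> B \<subseteq> B' \<longrightarrow> B' = B))"

text \<open>\<open>H\<close> may be disconnected; its parabolic subgroups are taken in the identity component, which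
  is itself one of them.\<close>

definition rational_parabolic :: "nat \<Rightarrow> complex mat set \<Rightarrow> complex mat set \<Rightarrow> bool" where
  "rational_parabolic N H P \<longleftrightarrow>
     algebraic_group N \<rat> P \<and> P \<subseteq> zariski_component N H \<and>
     (\<exists>B \<subseteq> P. borel_subgroup N (zariski_component N H) B)"

definition unipotent_radical :: "nat \<Rightarrow> complex mat set \<Rightarrow> complex mat set" where
  "unipotent_radical N P = \<Union>{U. algebraic_group N UNIV U \<and> zariski_connected N U \<and>
     U \<lhd> subgrp N P \<and> (\<forall>u\<in>U. (u - 1\<^sub>m N) ^\<^sub>m N = 0\<^sub>m N N)}"

definition split_torus :: "nat \<Rightarrow> complex mat set \<Rightarrow> bool" where
  "split_torus N S \<longleftrightarrow>
     algebraic_group N \<rat> S \<and> zariski_connected N S \<and>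
     (\<exists>h \<in> carrier (GLn N). (\<forall>i<N. \<forall>j<N. h $$ (i, j) \<in> \<rat>) \<and>
        (\<forall>s\<in>S. diagonal_mat (mconj N h s)))"

text \<open>Torus lifts to \<open>P\<close> of the maximal rationally split torus in the centre of
  \<open>P/R\<^sub>u(P)\<close>.\<close>

definition central_split_torus :: "nat \<Rightarrow> complex mat set \<Rightarrow> complex mat set \<Rightarrow> bool" where
  "central_split_torus N P S \<longleftrightarrow>
     (let central = (\<lambda>S. split_torus N S \<and> S \<subseteq> P \<and>
            (\<forall>s\<in>S. \<forall>p\<in>P. s * p * minv N s * minv N p \<in> unipotent_radical N P))
      in central S \<and> (\<forall>S'. central S' \<and> S \<subseteq> S' \<longrightarrow> S' = S))"

definition complex_mat :: "real mat \<Rightarrow> complex mat" where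
  "complex_mat = map_mat complex_of_real"

definition real_points :: "nat \<Rightarrow> complex mat set \<Rightarrow> real mat set" where
  "real_points N H = {A \<in> carrier_mat N N. complex_mat A \<in> H}"

definition rational_points :: "nat \<Rightarrow> complex mat set \<Rightarrow> real mat set" where
  "rational_points N H = {A \<in> real_points N H. \<forall>i<N. \<forall>j<N. A $$ (i, j) \<in> \<rat>}"

definition integer_points :: "nat \<Rightarrow> complex mat set \<Rightarrow> real mat set" where
  "integer_points N H = {A \<in> real_points N H.
     \<forall>i<N. \<forall>j<N. A $$ (i, j) \<in> \<int> \<and> minv N A $$ (i, j) \<in> \<int>}"

definition arithmetic_datum :: "complex mat set \<Rightarrow> datum \<Rightarrow> bool" where
  "arithmetic_datum H D \<longleftrightarrow>
     algebraic_group (deg D) \<rat> H \<and> grp D = real_points (deg D) H \<and> locsym_datum D \<and>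
     lat D \<subseteq> rational_points (deg D) H \<and>
     commensurable (deg D) (lat D) (integer_points (deg D) H)"

definition arithmetic :: "datum \<Rightarrow> bool" where
  "arithmetic D \<longleftrightarrow>
     (\<exists>H D' F. arithmetic_datum H D' \<and> affine_iso 1 (\<lambda>_. D') D F \<and>
        intertwines 1 (\<lambda>_. D') F (\<lambda>_. lat D') (lat D))"

section \<open>The compactifications\<close>

text \<open>A point of a compactification is a \<open>\<Gamma>\<close>-orbit of pairs \<open>(Q, e)\<close>: for the Borel--Serre
  compactification \<open>Q\<close> is a rational parabolic subgroup and \<open>e\<close> an orbit in \<open>G/K\<close> of the geodesic
  action of \<open>A\<^sub>Q\<close>. Interior points are the orbits of \<open>(L, {x})\<close> with \<open>x\<close> in \<open>G/K\<close> and a fixed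
  label \<open>L\<close>, namely the identity component of the algebraic group (whose geodesic action is
  trivial). The same type of points, with \<open>L = {}\<close>, serves for the truncated rank one quotients.\<close>

type_synonym point = "(complex mat set \<times> real mat set set) set"

definition lattice_orbit :: "datum \<Rightarrow> complex mat set \<times> real mat set set \<Rightarrow> point" where
  "lattice_orbit D = (\<lambda>(Q, e).
     {(mconj (deg D) (complex_mat \<gamma>) ` Q, (`) ((*) \<gamma>) ` e) | \<gamma>. \<gamma> \<in> lat D})"

definition interior_point :: "datum \<Rightarrow> complex mat set \<Rightarrow> real mat set \<Rightarrow> point" where
  "interior_point D L x = lattice_orbit D (L, {x})"

subsection \<open>Borel--Serre\<close>

text \<open>The lift of \<open>A\<^sub>P\<close> to the Levi subgroup stable under the Cartan involution at the base point
  \<open>K\<close>. If \<open>A\<close> is this lift, then \<open>a \<in> A\<close> acts geodesically on \<open>G/K\<close>, which is a single orbit of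
  the real points of \<open>P\<close>, by \<open>p K \<mapsto> p a K\<close>.\<close>

definition geodesic_torus ::
    "complex mat set \<Rightarrow> datum \<Rightarrow> complex mat set \<Rightarrow> real mat set \<Rightarrow> bool" where
  "geodesic_torus H D P A \<longleftrightarrow> (let N = deg D in
     rational_parabolic N H P \<and>
     (\<exists>\<theta> S u. cartan_involution N (grp D) (cpt D) \<theta> \<and> central_split_torus N P S \<and>
        u \<in> real_points N (unipotent_radical N P) \<and>
        A = mconj N u ` identity_component N (real_points N S) \<and>
        (\<forall>a\<in>A. \<theta> a = minv N a)))"

definition roots :: "nat \<Rightarrow> complex mat set \<Rightarrow> real mat set \<Rightarrow> (real mat \<Rightarrow> real) set" where
  "roots N P A = {\<alpha> \<in> extensional A.
     \<exists>X \<in> lie_algebra N (real_points N (unipotent_radical N P)).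
       X \<noteq> 0\<^sub>m N N \<and> (\<forall>a\<in>A. mconj N a X = \<alpha> a \<cdot>\<^sub>m X)}"

definition simple_roots :: "nat \<Rightarrow> complex mat set \<Rightarrow> real mat set \<Rightarrow> (real mat \<Rightarrow> real) set" where
  "simple_roots N P A = {\<alpha> \<in> roots N P A.
     \<not> (\<exists>\<beta>\<in>roots N P A. \<exists>\<gamma>\<in>roots N P A. \<forall>a\<in>A. \<alpha> a = \<beta> a * \<gamma> a)}"

text \<open>The corner of \<open>P\<close> is \<open>(G/K) \<times>\<^bsub>A\<^esub> [0,\<infinity>)\<^sup>r\<close>, where \<open>A\<close> embeds in
  \<open>[0,\<infinity>)\<^sup>r\<close> by \<open>a \<mapsto> (1/\<alpha>\<^sub>i(a))\<^sub>i\<close> for the simple roots \<open>\<alpha>\<^sub>0, \<dots>, \<alpha>\<^bsub>r-1\<^esub>\<close>. It is parametrized by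
  the pairs \<open>(p, t)\<close> of a real point \<open>p\<close> of \<open>P\<close> and \<open>t \<in> [0,\<infinity>)\<^sup>r\<close>. The point \<open>(p, t)\<close> lies in the
  stratum of the parabolic \<open>Q \<supseteq> P\<close> whose torus is the intersection of the kernels of the \<open>\<alpha>\<^sub>i\<close> with
  \<open>t\<^sub>i \<noteq> 0\<close>.\<close>

definition corner_map ::
    "complex mat set \<Rightarrow> datum \<Rightarrow> complex mat set \<Rightarrow> real mat set \<Rightarrow> nat \<Rightarrow>
     (nat \<Rightarrow> real mat \<Rightarrow> real) \<Rightarrow> (nat \<Rightarrow> real) \<Rightarrow> point" where
  "corner_map H D P A r \<alpha> z =
     (let N = deg D; p = mat_of N z; t = (\<lambda>i. z (N * N + i));
          B = {a \<in> A. \<forall>i<r. t i \<noteq> 0 \<longrightarrow> \<alpha> i a = 1};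
          Q = (THE Q. P \<subseteq> Q \<and> geodesic_torus H D Q B);
          a = (SOME a. a \<in> A \<and> (\<forall>i<r. t i \<noteq> 0 \<longrightarrow> \<alpha> i a = 1 / t i))
      in lattice_orbit D (Q, (\<lambda>b. coset D (p * a * b)) ` B))"

definition borel_serre :: "complex mat set \<Rightarrow> datum \<Rightarrow> nat \<Rightarrow> point mfd" where
  "borel_serre H D n = (let N = deg D in
     param_mfd n
       {(N * N + r,
         {z \<in> eucl (N * N + r). mat_of N z \<in> real_points N P \<and> (\<forall>i<r. 0 \<le> z (N * N + i))},
         corner_map H D P A r \<alpha>) | P A r \<alpha>.
        geodesic_torus H D P A \<and> bij_betw \<alpha> {..<r} (simple_roots N P A)})"

subsection \<open>Truncation in rank one\<close>

definition transvection :: "datum \<Rightarrow> (real mat \<Rightarrow> real mat) \<Rightarrow> (real \<Rightarrow> real mat) \<Rightarrow> bool" where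
  "transvection D \<theta> c \<longleftrightarrow>
     range c \<subseteq> grp D \<and> c 0 = 1\<^sub>m (deg D) \<and> (\<forall>s t. c (s + t) = c s * c t) \<and>
     continuous_map euclideanreal (mat_top (deg D)) c \<and> (\<forall>s. \<theta> (c s) = c (- s)) \<and>
     (\<exists>s. c s \<noteq> 1\<^sub>m (deg D))"

definition real_rank_one :: "datum \<Rightarrow> bool" where
  "real_rank_one D \<longleftrightarrow>
     (\<exists>\<theta>. cartan_involution (deg D) (grp D) (cpt D) \<theta> \<and> (\<exists>c. transvection D \<theta> c) \<and>
        (\<forall>c c'. transvection D \<theta> c \<and> transvection D \<theta> c' \<and> (\<forall>s t. c s * c' t = c' t * c s)
           \<longrightarrow> (\<exists>r. \<forall>s. c' s = c (r * s))))"

definition contracted :: "datum \<Rightarrow> (real \<Rightarrow> real mat) \<Rightarrow> real mat set" where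
  "contracted D c = {u \<in> grp D.
     limitin (mat_top (deg D)) (\<lambda>s. c (- s) * u * c s) (1\<^sub>m (deg D)) at_top}"

text \<open>In rank one the orbits of \<open>contracted D c\<close> are the horospheres centred at the endpoint of
  the geodesic ray \<open>s \<mapsto> c s K\<close>; \<open>horoball D g c I\<close> is the union, translated by \<open>g\<close>, of
  those through its points with parameter in \<open>I\<close>.\<close>

definition horoball ::
    "datum \<Rightarrow> real mat \<Rightarrow> (real \<Rightarrow> real mat) \<Rightarrow> real set \<Rightarrow> real mat set set" where
  "horoball D g c I = {coset D (g * u * c s) | u s. u \<in> contracted D c \<and> s \<in> I}"

definition thick_part ::
    "datum \<Rightarrow> nat \<Rightarrow> (nat \<Rightarrow> real mat) \<Rightarrow> (nat \<Rightarrow> real \<Rightarrow> real mat) \<Rightarrow> real \<Rightarrow> real mat set" where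
  "thick_part D q g c b =
     {h \<in> grp D. \<forall>i<q. \<forall>\<gamma>\<in>lat D. coset D h \<notin> horoball D (\<gamma> * g i) (c i) {b<..}}"

text \<open>Disjoint embedded cusps \<open>[0,\<infinity>) \<times> S\<close> with compact complement.\<close>

definition cusp_system ::
    "datum \<Rightarrow> nat \<Rightarrow> (nat \<Rightarrow> real mat) \<Rightarrow> (nat \<Rightarrow> real \<Rightarrow> real mat) \<Rightarrow> bool" where
  "cusp_system D q g c \<longleftrightarrow>
     (\<exists>\<theta>. cartan_involution (deg D) (grp D) (cpt D) \<theta> \<and>
        (\<forall>i<q. g i \<in> grp D \<and> transvection D \<theta> (c i))) \<and>
     (\<forall>\<gamma>\<in>lat D. \<forall>i<q. \<forall>j<q.
        horoball D (\<gamma> * g i) (c i) {0..} \<inter> horoball D (g j) (c j) {0..} \<noteq> {} \<longrightarrow>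
        i = j \<and> (\<forall>t\<ge>0. horoball D (\<gamma> * g i) (c i) {t..} = horoball D (g i) (c i) {t..})) \<and>
     compactin (quotient_space D) (double_coset D ` thick_part D q g c 0)"

definition truncation ::
    "datum \<Rightarrow> nat \<Rightarrow> nat \<Rightarrow> (nat \<Rightarrow> real mat) \<Rightarrow> (nat \<Rightarrow> real \<Rightarrow> real mat) \<Rightarrow> real \<Rightarrow> point mfd" where
  "truncation D n q g c b = (let N = deg D in
     param_mfd n
       {(N * N, {z \<in> eucl (N * N). mat_of N z \<in> thick_part D q g c b},
         \<lambda>z. interior_point D {} (coset D (mat_of N z)))})"

subsection \<open>Compactifications of locally symmetric manifolds\<close>

definition basic_compactification :: "datum \<Rightarrow> complex mat set \<Rightarrow> point mfd \<Rightarrow> bool" where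
  "basic_compactification D L Q \<longleftrightarrow>
     locally_symmetric D \<and> manifold_with_corners Q \<and>
     ((\<exists>H. arithmetic_datum H D \<and> L = zariski_component (deg D) H \<and>
           Q = borel_serre H D (mdim Q)) \<or>
      (real_rank_one D \<and> \<not> arithmetic D \<and> L = {} \<and>
       (\<exists>q g c b. 0 < b \<and> cusp_system D q g c \<and> Q = truncation D (mdim Q) q g c b)))"

text \<open>\<open>D\<close> is regularly covered by the product of the \<open>E j\<close>, and \<open>e \<gamma>\<close> is the diffeomorphism of the
  product of the compactified factors that agrees with the action of \<open>\<gamma>\<close> on the points whose
  components are interior points.\<close>

definition reducible_compactification :: "datum \<Rightarrow> (nat \<Rightarrow> point) set mfd \<Rightarrow> bool" where
  "reducible_compactification D X \<longleftrightarrow>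
     locally_symmetric D \<and>
     (\<exists>k E L Q F e. 2 \<le> k \<and>
        (\<forall>j<k. basic_compactification (E j) (L j) (Q j) \<and> \<not> virtually_splits (E j)) \<and>
        finite_cover k E D F \<and>
        product_lattice k E D F \<lhd> subgrp (deg D) (lat D) \<and>
        (\<forall>\<gamma>\<in>lat D. diffeomorphism (product_mfd k Q) (product_mfd k Q) (e \<gamma>) \<and>
           (\<forall>x\<in>prod_points k E. \<forall>x'\<in>prod_points k E.
              F x' = (*) \<gamma> ` F x \<and>
              (\<lambda>j\<in>{..<k}. interior_point (E j) (L j) (x j)) \<in> topspace (mtop (product_mfd k Q)) \<longrightarrow>
              e \<gamma> (\<lambda>j\<in>{..<k}. interior_point (E j) (L j) (x j)) =
                (\<lambda>j\<in>{..<k}. interior_point (E j) (L j) (x' j)))) \<and>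
        X = quotient_mfd (product_mfd k Q)
              {(y, y'). y \<in> topspace (mtop (product_mfd k Q)) \<and> (\<exists>\<gamma>\<in>lat D. y' = e \<gamma> y)})"

definition compactified_locally_symmetric :: "'a mfd \<Rightarrow> bool" where
  "compactified_locally_symmetric X \<longleftrightarrow>
     manifold_with_corners X \<and>
     ((\<exists>D L Q f. basic_compactification D L Q \<and> diffeomorphism X Q f) \<or>
      (\<exists>D Y f. reducible_compactification D Y \<and> diffeomorphism X Y f))"

section \<open>The reflection group trick\<close>

inductive braid_eq :: "('w, 'b) monoid_scheme \<Rightarrow> 'w set \<Rightarrow> 'w list \<Rightarrow> 'w list \<Rightarrow> bool"
  for W :: "('w, 'b) monoid_scheme" and S :: "'w set" where
  refl: "braid_eq W S u u"
| sym: "braid_eq W S u v \<Longrightarrow> braid_eq W S v u"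
| trans: "braid_eq W S u v \<Longrightarrow> braid_eq W S v w \<Longrightarrow> braid_eq W S u w"
| relator: "s \<in> S \<Longrightarrow> t \<in> S \<Longrightarrow>
    braid_eq W S (u @ concat (replicate (group.ord W (s \<otimes>\<^bsub>W\<^esub> t)) [s, t]) @ v) (u @ v)"

text \<open>\<open>W\<close> is generated by involutions \<open>S\<close>, subject only to the relations \<open>(st)\<^bsup>ord(st)\<^esup> = 1\<close>.
  If \<open>st\<close> has infinite order then \<open>ord(st) = 0\<close> and the relation is void.\<close>

definition coxeter_system :: "('w, 'b) monoid_scheme \<Rightarrow> 'w set \<Rightarrow> bool" where
  "coxeter_system W S \<longleftrightarrow>
     group W \<and> S \<subseteq> carrier W \<and> generate W S = carrier W \<and> (\<forall>s\<in>S. group.ord W s = 2) \<and>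
     (\<forall>w\<in>lists S. foldr (\<otimes>\<^bsub>W\<^esub>) w \<one>\<^bsub>W\<^esub> = \<one>\<^bsub>W\<^esub> \<longrightarrow> braid_eq W S w [])"

definition coxeter_nerve :: "('w, 'b) monoid_scheme \<Rightarrow> 'w set \<Rightarrow> 'w set set" where
  "coxeter_nerve W S = {T. T \<noteq> {} \<and> T \<subseteq> S \<and> finite (generate W T)}"

definition mirror_nerve :: "'w set \<Rightarrow> ('w \<Rightarrow> 'a set) \<Rightarrow> 'w set set" where
  "mirror_nerve S X = {T. T \<noteq> {} \<and> T \<subseteq> S \<and> (\<Inter>s\<in>T. X s) \<noteq> {}}"

definition reflection_rel ::
    "('w, 'b) monoid_scheme \<Rightarrow> 'w set \<Rightarrow> ('w \<Rightarrow> 'a set) \<Rightarrow> 'a set \<Rightarrow> (('w \<times> 'a) \<times> ('w \<times> 'a)) set" where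
  "reflection_rel W S X Q = {((h, x), (g, y)). h \<in> carrier W \<and> g \<in> carrier W \<and> x \<in> Q \<and> x = y \<and>
     inv\<^bsub>W\<^esub> h \<otimes>\<^bsub>W\<^esub> g \<in> generate W {s \<in> S. x \<in> X s}}"

definition left_act :: "('w, 'b) monoid_scheme \<Rightarrow> 'w \<Rightarrow> ('w \<times> 'a) set \<Rightarrow> ('w \<times> 'a) set" where
  "left_act W w = (`) (\<lambda>(h, x). (w \<otimes>\<^bsub>W\<^esub> h, x))"

text \<open>\<open>U\<close> is \<open>U(W, Q)\<close> with a smooth structure for which \<open>W\<close> acts by diffeomorphisms and
  \<open>x \<mapsto> [1, x]\<close> is a smooth embedding of the manifold with corners \<open>Q\<close>.\<close>

definition reflection_manifold ::
    "('w, 'b) monoid_scheme \<Rightarrow> 'w set \<Rightarrow> ('w \<Rightarrow> 'a set) \<Rightarrow> 'a mfd \<Rightarrow> ('w \<times> 'a) set mfd \<Rightarrow> bool" where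
  "reflection_manifold W S X Q U \<longleftrightarrow>
     (let q = (\<lambda>p. reflection_rel W S X (topspace (mtop Q)) `` {p});
          j = (\<lambda>x. q (\<one>\<^bsub>W\<^esub>, x))
      in mdim U = mdim Q \<and>
         mtop U = quotient_topology (prod_topology (discrete_topology (carrier W)) (mtop Q)) q \<and>
         smooth_manifold U \<and>
         (\<forall>w\<in>carrier W. diffeomorphism U U (left_act W w)) \<and>
         smooth_map Q (topspace (mtop Q)) U j \<and>
         smooth_map U (j ` topspace (mtop Q)) Q (the_inv_into (topspace (mtop Q)) j))"

definition piecewise_locally_symmetric :: "('w \<times> 'a) set set mfd \<Rightarrow> bool" where
  "piecewise_locally_symmetric M \<longleftrightarrow>
     (\<exists>(Q :: 'a mfd) (W :: 'w monoid) S X U W'.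
        compactified_locally_symmetric Q \<and>
        coxeter_system W S \<and> bij_betw X S (mirrors Q) \<and>
        coxeter_nerve W S = mirror_nerve S X \<and>
        reflection_manifold W S X Q U \<and>
        subgroup W' W \<and> torsion_free W W' \<and>
        M = quotient_mfd U {(x, y). x \<in> topspace (mtop U) \<and> (\<exists>w\<in>W'. y = left_act W w x)})"

section \<open>Riemannian metrics and isometries\<close>

text \<open>A Riemannian metric is given by its matrices of coefficients in the charts.\<close>

type_synonym 'a metric_coeffs = "'a chart \<Rightarrow> 'a \<Rightarrow> nat \<Rightarrow> nat \<Rightarrow> real"

definition jacobian :: "((nat \<Rightarrow> real) \<Rightarrow> nat \<Rightarrow> real) \<Rightarrow> (nat \<Rightarrow> real) \<Rightarrow> nat \<Rightarrow> nat \<Rightarrow> real" where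
  "jacobian F z k i = deriv (\<lambda>t. F (z(i := t)) k) (z i)"

definition preserves_metric :: "'a mfd \<Rightarrow> 'a metric_coeffs \<Rightarrow> ('a \<Rightarrow> 'a) \<Rightarrow> bool" where
  "preserves_metric M g f \<longleftrightarrow>
     (\<forall>c\<in>charts M. \<forall>d\<in>charts M. \<forall>x\<in>fst c. f x \<in> fst d \<longrightarrow>
        (\<forall>i<mdim M. \<forall>j<mdim M. g c x i j =
           (\<Sum>k<mdim M. \<Sum>l<mdim M.
              jacobian (loc_rep c d f) (snd c x) k i * jacobian (loc_rep c d f) (snd c x) l j *
              g d (f x) k l)))"

definition riemannian_metric :: "'a mfd \<Rightarrow> 'a metric_coeffs \<Rightarrow> bool" where
  "riemannian_metric M g \<longleftrightarrow>
     (\<forall>c\<in>charts M.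
        (\<forall>i<mdim M. \<forall>j<mdim M.
           smooth_real (mdim M) (snd c ` fst c) (\<lambda>z. g c (the_inv_into (fst c) (snd c) z) i j)) \<and>
        (\<forall>x\<in>fst c. (\<forall>i<mdim M. \<forall>j<mdim M. g c x i j = g c x j i) \<and>
           (\<forall>v. (\<exists>i<mdim M. v i \<noteq> 0) \<longrightarrow>
              0 < (\<Sum>i<mdim M. \<Sum>j<mdim M. g c x i j * v i * v j)))) \<and>
     preserves_metric M g (\<lambda>x. x)"

definition isometry_group :: "'a mfd \<Rightarrow> 'a metric_coeffs \<Rightarrow> ('a \<Rightarrow> 'a) monoid" where
  "isometry_group M g = BijGroup (topspace (mtop M))
     \<lparr>carrier := {f \<in> Bij (topspace (mtop M)). diffeomorphism M M f \<and> preserves_metric M g f}\<rparr>"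

section \<open>The fundamental group and its outer automorphisms\<close>

definition path_from_to :: "'a topology \<Rightarrow> 'a \<Rightarrow> 'a \<Rightarrow> (real \<Rightarrow> 'a) \<Rightarrow> bool" where
  "path_from_to X x y p \<longleftrightarrow> pathin X p \<and> p 0 = x \<and> p 1 = y"

definition path_join :: "(real \<Rightarrow> 'a) \<Rightarrow> (real \<Rightarrow> 'a) \<Rightarrow> real \<Rightarrow> 'a" where
  "path_join p q = (\<lambda>t. if t \<le> 1/2 then p (2 * t) else q (2 * t - 1))"

definition loop_class :: "'a topology \<Rightarrow> 'a \<Rightarrow> (real \<Rightarrow> 'a) \<Rightarrow> (real \<Rightarrow> 'a) set" where
  "loop_class X x p = {q. path_from_to X x x q \<and>
     homotopic_with (\<lambda>r. r 0 = x \<and> r 1 = x) (top_of_set {0..1}) X p q}"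

definition fundamental_group :: "'a topology \<Rightarrow> 'a \<Rightarrow> (real \<Rightarrow> 'a) set monoid" where
  "fundamental_group X x =
     \<lparr>carrier = loop_class X x ` {p. path_from_to X x x p},
      mult = (\<lambda>A B. \<Union>p\<in>A. \<Union>q\<in>B. loop_class X x (path_join p q)),
      one = loop_class X x (\<lambda>_. x)\<rparr>"

definition inner_automorphisms :: "('a, 'b) monoid_scheme \<Rightarrow> ('a \<Rightarrow> 'a) set" where
  "inner_automorphisms G =
     {\<lambda>x\<in>carrier G. g \<otimes>\<^bsub>G\<^esub> x \<otimes>\<^bsub>G\<^esub> inv\<^bsub>G\<^esub> g | g. g \<in> carrier G}"

definition Out :: "('a, 'b) monoid_scheme \<Rightarrow> ('a \<Rightarrow> 'a) set monoid" where
  "Out G = AutoGroup G Mod inner_automorphisms G"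

text \<open>The coset consisting of the automorphisms \<open>[r] \<mapsto> [p \<cdot> (f \<circ> r) \<cdot> p\<^sup>-\<^sup>1]\<close>, where \<open>p\<close> runs over
  the paths from the base point to its image.\<close>

definition outer_action ::
    "'a topology \<Rightarrow> 'a \<Rightarrow> ('a \<Rightarrow> 'a) \<Rightarrow> ((real \<Rightarrow> 'a) set \<Rightarrow> (real \<Rightarrow> 'a) set) set" where
  "outer_action X x f = {\<phi> \<in> auto (fundamental_group X x).
     \<exists>p. path_from_to X x (f x) p \<and>
       (\<forall>r. path_from_to X x x r \<longrightarrow> \<phi> (loop_class X x r) =
          loop_class X x (path_join (path_join p (\<lambda>t. f (r t))) (\<lambda>t. p (1 - t))))}"

end

theory Submission
  imports Defs
begin

text \<open>The isometries of a closed Riemannian manifold form an equicontinuous family: in charts, the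
  coefficients of the metric are bounded above and below, hence so are the partial derivatives of
  isometries. Equicontinuity yields a finite open cover, the same for all isometries, each member of
  which is mapped by an isometry into one of finitely many coordinate boxes. Two isometries that
  send every member of the cover to the same box are joined by short paths, unique up to homotopy,
  so they induce the same outer automorphism. Therefore the isometries induce only finitely many
  outer automorphisms, whereas a section of the action would realize all of the infinitely many.\<close>

text \<open>Closeness of maps is expressed through boxes alone; no distance function on
  \<open>M\<close> enters. This shapes two choices. (1) A box carries two concentric cubes: an
  isometry takes the centre of a small neighbourhood into an inner box, and the gap to the outer box
  is the room in which the derivative bound keeps the rest of the neighbourhood. The bound compares
  lengths: coordinate vectors of the source chart have bounded length, and in the target chart a
  vector of bounded length has bounded components. (2) A point may lie in several members of the
  cover, each offering its own box for the joining path. For uniqueness up to homotopy, two boxes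
  that meet must lie in a common set in which paths with the same ends are homotopic. The union of
  two cubes from different charts need not be such a set, so the boxes are chosen as a barycentric
  refinement of a coarser box cover. The joining path at the base point only changes the path used
  for conjugation, which is why outer automorphisms, and not automorphisms, are compared.\<close>

section \<open>Path homotopy in abstract topological spaces\<close>

text \<open>The fixed ends are read off from the first path, so that one relation covers composable
  paths with arbitrary ends; for loops at \<open>x\<close> it is the relation inside
  \<open>loop_class\<close>.\<close>

definition path_homotopic :: "'a topology \<Rightarrow> (real \<Rightarrow> 'a) \<Rightarrow> (real \<Rightarrow> 'a) \<Rightarrow> bool" where
  "path_homotopic X p q \<longleftrightarrow>
     homotopic_with (\<lambda>r. r 0 = p 0 \<and> r 1 = p 1) (top_of_set {0..1}) X p q"

lemma path_join_ends [simp]: "path_join p q 0 = p 0" "path_join p q 1 = q 1"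
  by (simp_all add: path_join_def)

lemma path_homotopicD:
  assumes "path_homotopic X p q"
  shows "pathin X p" "pathin X q" "q 0 = p 0" "q 1 = p 1"
  using homotopic_with_imp_continuous_maps[OF assms[unfolded path_homotopic_def]]
    homotopic_with_imp_property[OF assms[unfolded path_homotopic_def]]
  by (auto simp: pathin_def)

lemma path_homotopic_refl [simp]: "path_homotopic X p p \<longleftrightarrow> pathin X p"
  by (simp add: path_homotopic_def pathin_def)

lemma path_homotopic_sym: "path_homotopic X p q \<Longrightarrow> path_homotopic X q p"
  using path_homotopicD(3,4)[of X p q]
  unfolding path_homotopic_def by (simp add: homotopic_with_sym)

lemma path_homotopic_trans [trans]:
  "path_homotopic X p q \<Longrightarrow> path_homotopic X q r \<Longrightarrow> path_homotopic X p r"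
  using path_homotopicD(3,4)[of X p q]
  unfolding path_homotopic_def by (auto intro: homotopic_with_trans)

text \<open>\<open>homotopic_with\<close> unfolds to an explicit map on the square because the
  endpoint condition depends only on values at \<open>0\<close> and \<open>1\<close>, which lie in
  the domain. The first argument of \<open>h\<close> is the homotopy time, the second the path
  parameter.\<close>

lemma path_homotopic_iff:
  "path_homotopic X p q \<longleftrightarrow>
     (\<exists>h. continuous_map (prod_topology (top_of_set {0..1::real}) (top_of_set {0..1})) X h \<and>
        (\<forall>s\<in>{0..1}. h (0, s) = p s) \<and> (\<forall>s\<in>{0..1}. h (1, s) = q s) \<and>
        (\<forall>t\<in>{0..1}. h (t, 0) = p 0 \<and> h (t, 1) = p 1))"
proof -
  have "(h 0 = p 0 \<and> h 1 = p 1) = (k 0 = p 0 \<and> k 1 = p 1)"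
    if "\<And>x. x \<in> topspace (top_of_set {0..1}) \<Longrightarrow> h x = k x" for h k :: "real \<Rightarrow> 'a"
    using that[of 0] that[of 1] by simp
  note * = homotopic_with[of "top_of_set {0..1}" "\<lambda>r. r 0 = p 0 \<and> r 1 = p 1", OF this]
  show ?thesis
    unfolding path_homotopic_def by (subst *) simp_all
qed

lemma loop_class_eq_iff:
  assumes "path_from_to X x x p" "path_from_to X x x q"
  shows "loop_class X x p = loop_class X x q \<longleftrightarrow> path_homotopic X p q"
proof -
  have cls: "loop_class X x r = {s. path_homotopic X r s}" if "path_from_to X x x r" for r
  proof -
    have r: "r 0 = x" "r 1 = x"
      using that by (auto simp: path_from_to_def)
    then have "path_from_to X x x s" if "path_homotopic X r s" for s
      using path_homotopicD[OF that] by (simp add: path_from_to_def)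
    then show ?thesis
      unfolding loop_class_def path_homotopic_def r by blast
  qed
  have "path_homotopic X q q"
    using assms by (simp add: path_from_to_def)
  then show ?thesis
    unfolding cls[OF assms(1)] cls[OF assms(2)]
    by (blast intro: path_homotopic_sym path_homotopic_trans)
qed

lemma path_homotopic_join:
  assumes p: "path_homotopic X p p'" and q: "path_homotopic X q q'" and pq: "p 1 = q 0"
  shows "path_homotopic X (path_join p q) (path_join p' q')"
proof -
  let ?I = "top_of_set {0..1::real}"
  obtain h where h: "continuous_map (prod_topology ?I ?I) X h"
      "\<And>s. s \<in> {0..1} \<Longrightarrow> h (0, s) = p s" "\<And>s. s \<in> {0..1} \<Longrightarrow> h (1, s) = p' s"
      "\<And>t. t \<in> {0..1} \<Longrightarrow> h (t, 0) = p 0" "\<And>t. t \<in> {0..1} \<Longrightarrow> h (t, 1) = p 1"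
    using p unfolding path_homotopic_iff by blast
  obtain k where k: "continuous_map (prod_topology ?I ?I) X k"
      "\<And>s. s \<in> {0..1} \<Longrightarrow> k (0, s) = q s" "\<And>s. s \<in> {0..1} \<Longrightarrow> k (1, s) = q' s"
      "\<And>t. t \<in> {0..1} \<Longrightarrow> k (t, 0) = q 0" "\<And>t. t \<in> {0..1} \<Longrightarrow> k (t, 1) = q 1"
    using q unfolding path_homotopic_iff by blast
  \<comment> \<open>The two homotopies are run side by side. They agree over
    \<open>snd z = 1/2\<close>, where \<open>h\<close> is constantly \<open>p 1\<close> and
    \<open>k\<close> constantly \<open>q 0\<close>.\<close>
  let ?H = "\<lambda>z::real \<times> real. if snd z \<le> 1/2 then h (fst z, 2 * snd z) else k (fst z, 2 * snd z - 1)"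
  have "continuous_map (top_of_set ({0..1} \<times> {0..1})) X ?H"
  proof (rule continuous_map_cases_le)
    show "continuous_map (subtopology (top_of_set ({0..1} \<times> {0..1})) {x \<in> topspace (top_of_set ({0..1} \<times> {0..1})). snd x \<le> 1/2}) X
        (\<lambda>z. h (fst z, 2 * snd z))"
      by (rule continuous_map_compose[OF _ h(1), unfolded o_def])
        (auto simp: subtopology_subtopology prod_topology_subtopology intro!: continuous_intros)
    show "continuous_map (subtopology (top_of_set ({0..1} \<times> {0..1})) {x \<in> topspace (top_of_set ({0..1} \<times> {0..1})). 1/2 \<le> snd x}) X
        (\<lambda>z. k (fst z, 2 * snd z - 1))"
      by (rule continuous_map_compose[OF _ k(1), unfolded o_def])
        (auto simp: subtopology_subtopology prod_topology_subtopology intro!: continuous_intros)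
    show "h (fst z, 2 * snd z) = k (fst z, 2 * snd z - 1)"
      if "z \<in> topspace (top_of_set ({0..1} \<times> {0..1}))" "snd z = 1/2" for z
    proof -
      have "fst z \<in> {0..1}" "2 * snd z = 1"
        using that by auto
      then show ?thesis
        using h(5)[of "fst z"] k(4)[of "fst z"] pq by simp
    qed
  qed (auto intro!: continuous_intros)
  then have "continuous_map (prod_topology ?I ?I) X ?H"
    by (simp add: prod_topology_subtopology subtopology_subtopology Times_Int_Times)
  then show ?thesis
    unfolding path_homotopic_iff path_join_def
    by (intro exI[of _ ?H]) (use h k in auto)
qed

lemma pathin_join: "pathin X p \<Longrightarrow> pathin X q \<Longrightarrow> p 1 = q 0 \<Longrightarrow> pathin X (path_join p q)"
  using path_homotopic_join[of X p p q q] by simp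

text \<open>The straight line from \<phi> to \<psi> stays in the unit interval by convexity, and
  composing it with \<open>p\<close> is the homotopy. All laws for joins below are instances with a
  suitable piecewise linear reparametrization of a single path; with \<phi> = \<psi> it yields
  continuity of a reparametrized path.\<close>

lemma path_homotopic_reparam:
  assumes p: "pathin X p"
    and \<phi>: "continuous_on {0..1} \<phi>" "\<And>s. s \<in> {0..1} \<Longrightarrow> \<phi> s \<in> {0..1}"
    and \<psi>: "continuous_on {0..1} \<psi>" "\<And>s. s \<in> {0..1} \<Longrightarrow> \<psi> s \<in> {0..1}"
    and eq: "\<phi> 0 = \<psi> 0" "\<phi> 1 = \<psi> 1"
    and q: "\<And>s. s \<in> {0..1} \<Longrightarrow> q s = p (\<phi> s)" and r: "\<And>s. s \<in> {0..1} \<Longrightarrow> r s = p (\<psi> s)"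
  shows "path_homotopic X q r"
proof -
  let ?g = "\<lambda>z. (1 - fst z) * \<phi> (snd z) + fst z * \<psi> (snd z)"
  have "?g z \<in> {0..1}" if "z \<in> {0..1} \<times> {0..1}" for z
  proof -
    have "(1 - fst z) *\<^sub>R \<phi> (snd z) + fst z *\<^sub>R \<psi> (snd z) \<in> {0..1}"
      using that by (intro convexD[OF convex_real_interval(5)] \<phi> \<psi>) auto
    then show ?thesis by simp
  qed
  moreover have "continuous_on ({0..1} \<times> {0..1}) ?g"
    by (intro continuous_intros continuous_on_compose2[OF \<phi>(1)] continuous_on_compose2[OF \<psi>(1)]) auto
  ultimately have "continuous_map (prod_topology (top_of_set {0..1}) (top_of_set {0..1})) (top_of_set {0..1}) ?g"
    by (simp add: prod_topology_subtopology subtopology_subtopology Times_Int_Times image_subset_iff)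
  then have "continuous_map (prod_topology (top_of_set {0..1}) (top_of_set {0..1})) X (p \<circ> ?g)"
    using p unfolding pathin_def by (rule continuous_map_compose)
  then show ?thesis
    unfolding path_homotopic_iff
    by (intro exI[of _ "p \<circ> ?g"]) (auto simp: q r eq algebra_simps)
qed

section \<open>Groupoid laws up to path homotopy\<close>

lemma path_homotopic_eq:
  assumes "pathin X p" "\<And>s. s \<in> {0..1} \<Longrightarrow> q s = p s"
  shows "path_homotopic X q p"
  by (rule path_homotopic_reparam[OF assms(1), of "\<lambda>s. s" "\<lambda>s. s"]) (auto simp: assms(2))

lemma path_homotopic_assoc:
  assumes "pathin X p" "pathin X q" "pathin X r" "p 1 = q 0" "q 1 = r 0"
  shows "path_homotopic X (path_join (path_join p q) r) (path_join p (path_join q r))"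
proof -
  \<comment> \<open>The left bracketing changes path at times 1/4 and 1/2, the right one at 1/2 and
    3/4. This is the piecewise linear map that takes 1/2 to 1/4 and 3/4 to 1/2, with slopes 1/2, 1
    and 2.\<close>
  let ?\<psi> = "\<lambda>s::real. max (s / 2) (max (min (s - 1/4) (1/2)) (2 * s - 1))"
  have P: "pathin X (path_join (path_join p q) r)"
    using assms by (intro pathin_join) auto
  show ?thesis
  proof (rule path_homotopic_reparam[OF P, of "\<lambda>s. s" ?\<psi>])
  show "continuous_on {0..1} ?\<psi>"
    by (intro continuous_intros) auto
  show "path_join p (path_join q r) s = path_join (path_join p q) r (?\<psi> s)" if "s \<in> {0..1}" for s
  proof -
    consider "s \<le> 1/2" | "1/2 < s" "s \<le> 3/4" | "3/4 < s" by linarith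
    then show ?thesis
    proof cases
      case 1
      then have "?\<psi> s = s / 2" by auto
      then show ?thesis using that 1 by (simp add: path_join_def)
    next
      case 2
      then have "?\<psi> s = s - 1/4" by auto
      then show ?thesis using that 2 by (simp add: path_join_def algebra_simps)
    next
      case 3
      then have "?\<psi> s = 2 * s - 1" by auto
      then show ?thesis using that 3 by (simp add: path_join_def algebra_simps)
    qed
  qed
qed auto
qed

lemma path_homotopic_rinv:
  assumes "pathin X p"
  shows "path_homotopic X (path_join p (\<lambda>t. p (1 - t))) (\<lambda>_. p 0)"
  \<comment> \<open>The tent function runs along \<open>p\<close> and back; it is contracted to the
    constant 0.\<close>
  by (rule path_homotopic_reparam[OF assms, of "\<lambda>s. min (2 * s) (2 - 2 * s)" "\<lambda>_. 0"])
    (auto simp: path_join_def intro!: continuous_intros)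

lemma path_homotopic_rid:
  assumes "pathin X p"
  shows "path_homotopic X (path_join p (\<lambda>_. p 1)) p"
  by (rule path_homotopic_reparam[OF assms, of "\<lambda>s. min (2 * s) 1" "\<lambda>s. s"])
    (auto simp: path_join_def intro!: continuous_intros)

lemma pathin_rev: "pathin X p \<Longrightarrow> pathin X (\<lambda>t. p (1 - t))"
  by (rule path_homotopicD(1)[of _ _ "\<lambda>t. p (1 - t)"],
      rule path_homotopic_reparam[of X p "\<lambda>t. 1 - t" "\<lambda>t. 1 - t"])
    (auto intro!: continuous_intros)

section \<open>Subpaths\<close>

definition subpath_of :: "(real \<Rightarrow> 'a) \<Rightarrow> real \<Rightarrow> real \<Rightarrow> real \<Rightarrow> 'a" where
  "subpath_of p a b = (\<lambda>s. p (a + s * (b - a)))"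

lemma subpath_param_bounds:
  fixes a b s :: real
  assumes "0 \<le> a" "a \<le> b" "b \<le> 1" "s \<in> {0..1}"
  shows "a \<le> a + s * (b - a)" "a + s * (b - a) \<le> b"
  using assms mult_left_le_one_le[of "b - a" s] by auto

lemma pathin_subpath_of:
  assumes "pathin X p" "0 \<le> a" "a \<le> b" "b \<le> 1"
  shows "pathin X (subpath_of p a b)"
  unfolding subpath_of_def path_homotopic_refl[symmetric]
  by (rule path_homotopic_reparam[OF assms(1), of "\<lambda>s. a + s * (b - a)" "\<lambda>s. a + s * (b - a)"])
    (use subpath_param_bounds[OF assms(2-4)] assms in \<open>force intro!: continuous_intros\<close>)+

lemma path_homotopic_subpath_of_join:
  assumes "pathin X p" "0 \<le> a" "a \<le> b" "b \<le> c" "c \<le> 1"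
  shows "path_homotopic X (path_join (subpath_of p a b) (subpath_of p b c)) (subpath_of p a c)"
proof (rule path_homotopic_reparam[OF assms(1)])
  \<comment> \<open>The \<open>min\<close> term moves from \<open>a\<close> to \<open>b\<close>
    during the first half, the \<open>max\<close> term from \<open>b\<close> to \<open>c\<close>
    during the second.\<close>
  let ?\<phi> = "\<lambda>s. a + min (2 * s) 1 * (b - a) + max (2 * s - 1) 0 * (c - b)"
  show "continuous_on {0..1} ?\<phi>"
    by (intro continuous_intros)
  show "continuous_on {0..1} (\<lambda>s. a + s * (c - a))"
    by (intro continuous_intros)
  show "?\<phi> s \<in> {0..1}" if "s \<in> {0..1}" for s
  proof (cases "s \<le> 1/2")
    case True
    then show ?thesis
      using assms that subpath_param_bounds[of a b "2 * s"] by auto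
  next
    case False
    then show ?thesis
      using assms that subpath_param_bounds[of b c "2 * s - 1"] by auto
  qed
  show "a + s * (c - a) \<in> {0..1}" if "s \<in> {0..1}" for s
    using assms that subpath_param_bounds[of a c s] by auto
  show "path_join (subpath_of p a b) (subpath_of p b c) s = p (?\<phi> s)" for s
    by (auto simp: path_join_def subpath_of_def)
qed (auto simp: subpath_of_def)

lemma path_join_image_subset:
  assumes "p ` {0..1} \<subseteq> V" "q ` {0..1} \<subseteq> V"
  shows "path_join p q ` {0..1} \<subseteq> V"
  using assms by (auto simp: path_join_def image_subset_iff)

lemma subpath_of_image_subset:
  assumes "p ` {a..b} \<subseteq> V" "a \<le> b"
  shows "subpath_of p a b ` {0..1} \<subseteq> V"
proof -
  have "a + s * (b - a) \<in> {a..b}" if "s \<in> {0..1}" for s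
    using that assms(2) mult_left_le_one_le[of "b - a" s] by auto
  then show ?thesis
    using assms(1) unfolding subpath_of_def by blast
qed

lemma subpath_of_ends [simp]: "subpath_of p a b 0 = p a" "subpath_of p a b 1 = p b"
  by (simp_all add: subpath_of_def)

text \<open>Inserting \<open>c\<close> followed by its reverse between \<open>u\<close> and the
  reverse of \<open>p\<close>, and then replacing \<open>u\<close> \<open>c\<close> by
  \<open>c\<close> \<open>v\<close>, turns conjugation of \<open>u\<close> by \<open>p\<close> into
  conjugation of \<open>v\<close> by the join of \<open>p\<close> and \<open>c\<close>. In the
  application \<open>u\<close> and \<open>v\<close> are the images of one loop under two maps and
  \<open>c\<close> joins the images of the base point.\<close>

lemma path_homotopic_transport:
  assumes p: "pathin X p" and u: "pathin X u" and v: "pathin X v" and c: "pathin X c"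
    and ends: "p 1 = u 0" "u 1 = c 0" "u 0 = u 1" "v 0 = c 1" "v 1 = c 1"
    and nat: "path_homotopic X (path_join u c) (path_join c v)"
  shows "path_homotopic X (path_join (path_join p u) (\<lambda>t. p (1 - t)))
           (path_join (path_join (path_join p c) v) (\<lambda>t. path_join p c (1 - t)))"
proof -
  note J = path_join_def
  let ?p' = "\<lambda>t. p (1 - t)" and ?c' = "\<lambda>t. c (1 - t)"
  note [simp] = p u v c pathin_rev[OF p] pathin_rev[OF c]
  have pc: "p 1 = c 0" using ends by simp
  have pin [simp]: "pathin X (path_join p u)" "pathin X (path_join p c)"
    "pathin X (path_join (path_join p c) v)" "pathin X (path_join c v)" "pathin X (path_join ?c' ?p')"
    "pathin X (path_join c (path_join ?c' ?p'))" "pathin X (path_join (path_join p u) c)"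
    using ends by (auto intro!: pathin_join)
  have topspace: "p 1 \<in> topspace X" using p path_finish_in_topspace by metis
  have 1: "path_homotopic X (path_join (path_join p c) v) (path_join (path_join p u) c)"
  proof -
    have "path_homotopic X (path_join (path_join p c) v) (path_join p (path_join c v))"
      using ends pc by (intro path_homotopic_assoc) auto
    also have "path_homotopic X \<dots> (path_join p (path_join u c))"
      using ends pc by (intro path_homotopic_join path_homotopic_sym[OF nat]) auto
    also have "path_homotopic X \<dots> (path_join (path_join p u) c)"
      using ends pc by (intro path_homotopic_sym[OF path_homotopic_assoc]) auto
    finally show ?thesis .
  qed
  have 2: "path_homotopic X (\<lambda>t. path_join p c (1 - t)) (path_join ?c' ?p')"
  proof (rule path_homotopic_eq)
    \<comment> \<open>At \<open>s = 1/2\<close> the two sides pick different branches of the joins,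
      and agree because \<open>p 1 = c 0\<close>.\<close>
    show "path_join p c (1 - s) = path_join ?c' ?p' s" for s
      using pc by (cases "s = 1/2") (auto simp: J algebra_simps)
  qed simp
  have 3: "path_homotopic X (path_join c (path_join ?c' ?p')) (path_join (\<lambda>_. c 0) ?p')"
  proof -
    have "path_homotopic X (path_join c (path_join ?c' ?p')) (path_join (path_join c ?c') ?p')"
      using pc by (intro path_homotopic_sym[OF path_homotopic_assoc]) auto
    also have "path_homotopic X \<dots> (path_join (\<lambda>_. c 0) ?p')"
      using pc by (intro path_homotopic_join path_homotopic_rinv) auto
    finally show ?thesis .
  qed
  have "path_homotopic X (path_join (path_join (path_join p c) v) (\<lambda>t. path_join p c (1 - t)))
      (path_join (path_join (path_join p u) c) (path_join ?c' ?p'))"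
    using ends pc by (intro path_homotopic_join 1 2) auto
  also have "path_homotopic X \<dots> (path_join (path_join p u) (path_join c (path_join ?c' ?p')))"
    using ends pc by (intro path_homotopic_assoc) auto
  also have "path_homotopic X \<dots> (path_join (path_join p u) (path_join (\<lambda>_. c 0) ?p'))"
    using ends pc by (intro path_homotopic_join 3) auto
  also have "path_homotopic X \<dots> (path_join (path_join (path_join p u) (\<lambda>_. c 0)) ?p')"
    using ends pc topspace by (intro path_homotopic_sym[OF path_homotopic_assoc]) auto
  also have "path_homotopic X \<dots> (path_join (path_join p u) ?p')"
    using ends pc path_homotopic_rid[OF pin(1)]
    by (intro path_homotopic_join[of X _ "path_join p u"]) auto
  finally show ?thesis by (rule path_homotopic_sym)
qed

section \<open>Coordinate boxes\<close>

text \<open>Cubes in place of round balls: each condition concerns one coordinate, which suits the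
  product topology on sequences and motion along coordinate axes.\<close>

definition cube :: "nat \<Rightarrow> (nat \<Rightarrow> real) \<Rightarrow> real \<Rightarrow> (nat \<Rightarrow> real) set" where
  "cube n w r = {z \<in> eucl n. \<forall>i<n. \<bar>z i - w i\<bar> \<le> r}"

definition open_cube :: "nat \<Rightarrow> (nat \<Rightarrow> real) \<Rightarrow> real \<Rightarrow> (nat \<Rightarrow> real) set" where
  "open_cube n w r = {z \<in> eucl n. \<forall>i<n. \<bar>z i - w i\<bar> < r}"

lemma open_cube_subset_cube: "r \<le> s \<Longrightarrow> open_cube n w r \<subseteq> cube n w s"
  by (fastforce simp: cube_def open_cube_def)

text \<open>The cube is a product of closed intervals and, from the index \<open>n\<close> on, of
  the singleton of 0, so it is compact by Tychonoff.\<close>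

lemma compact_cube: "compact (cube n w r)"
proof -
  have "cube n w r = PiE UNIV (\<lambda>i. if i < n then {w i - r..w i + r} else {0})"
    by (auto simp: cube_def eucl_def PiE_iff abs_le_iff extensional_def split: if_splits)
       (smt (verit))+
  then have "compactin (product_topology (\<lambda>i. euclidean) UNIV) (cube n w r)"
    by (auto simp: compactin_PiE)
  then show ?thesis
    by (simp add: euclidean_product_topology)
qed

lemma openin_open_cube: "openin (top_of_set (eucl n)) (open_cube n w r)"
proof -
  have "open_cube n w r = eucl n \<inter> (\<Inter>i<n. {z. \<bar>z i - w i\<bar> < r})"
    by (auto simp: open_cube_def)
  moreover have "open (\<Inter>i<n. {z::nat \<Rightarrow> real. \<bar>z i - w i\<bar> < r})"
    by (intro open_INT open_Collect_less ballI continuous_on_rabs continuous_on_diff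
        continuous_on_product_coordinates continuous_on_const) auto
  ultimately show ?thesis
    by (simp add: openin_open_Int)
qed

lemma ex_cube_subset:
  assumes U: "openin (top_of_set (eucl n)) U" and w: "w \<in> U"
  shows "\<exists>r>0. cube n w r \<subseteq> U"
proof -
  obtain T where T: "open T" "U = eucl n \<inter> T"
    using U by (auto simp: openin_open)
  have *: "openin (product_topology (\<lambda>i. euclidean) UNIV) T" "w \<in> T"
    using T w by (auto simp: euclidean_product_topology)
  then obtain Y where Y: "w \<in> PiE UNIV Y" "\<And>i. open (Y i)" "PiE UNIV Y \<subseteq> T"
    using product_topology_open_contains_basis[OF *] by auto
  have "\<exists>e>0. cball (w i) e \<subseteq> Y i" for i
    using Y(1) Y(2)[of i] open_contains_cball[of "Y i"] by (auto simp: PiE_iff)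
  then obtain e where e: "\<And>i. 0 < e i" "\<And>i. cball (w i) (e i) \<subseteq> Y i"
    by metis
  \<comment> \<open>Only the first \<open>n\<close> coordinates restrict the radius, as all points
    vanish beyond. The entry \<open>1\<close> keeps the minimum meaningful for
    \<open>n = 0\<close>.\<close>
  define r where "r = Min (insert 1 (e ` {..<n}))"
  have r: "0 < r" "\<And>i. i < n \<Longrightarrow> r \<le> e i"
    using e(1) by (auto simp: r_def)
  have "cube n w r \<subseteq> U"
  proof
    fix z assume z: "z \<in> cube n w r"
    have "z i \<in> Y i" for i
    proof (cases "i < n")
      case True
      then have "z i \<in> cball (w i) (e i)"
        using z r(2)[OF True] by (force simp: cube_def dist_real_def)
      then show ?thesis using e(2) by blast
    next
      case False
      then have "z i = w i"
        using z w T by (auto simp: cube_def eucl_def)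
      then show ?thesis using Y(1) by (auto simp: PiE_iff)
    qed
    then show "z \<in> U"
      using z T Y(3) by (auto simp: PiE_iff cube_def)
  qed
  with r show ?thesis by blast
qed

lemma open_cube_convex_combination:
  assumes "y \<in> open_cube n w r" "z \<in> open_cube n w r" "t \<in> {0..1}"
  shows "(\<lambda>i. (1 - t) * y i + t * z i) \<in> open_cube n w r"
proof -
  have "\<bar>(1 - t) * y i + t * z i - w i\<bar> < r" if "i < n" for i
  proof -
    have "(1 - t) *\<^sub>R y i + t *\<^sub>R z i \<in> ball (w i) r"
      using assms that by (intro convexD[OF convex_ball]) (auto simp: open_cube_def dist_real_def)
    then show ?thesis by (simp add: dist_real_def abs_minus_commute)
  qed
  then show ?thesis
    using assms by (simp add: open_cube_def eucl_def)
qed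

text \<open>Paths are confined to \<open>V\<close>, but the homotopies may use all of
  \<open>X\<close>.\<close>

definition path_simple :: "'a topology \<Rightarrow> 'a set \<Rightarrow> bool" where
  "path_simple X V \<longleftrightarrow>
     (\<forall>x\<in>V. \<forall>y\<in>V. \<exists>p. path_from_to X x y p \<and> p ` {0..1} \<subseteq> V) \<and>
     (\<forall>p q. pathin X p \<and> pathin X q \<and> p ` {0..1} \<subseteq> V \<and> q ` {0..1} \<subseteq> V \<and> p 0 = q 0 \<and> p 1 = q 1
        \<longrightarrow> path_homotopic X p q)"

abbreviation chart_inv :: "'a chart \<Rightarrow> (nat \<Rightarrow> real) \<Rightarrow> 'a" where
  "chart_inv c \<equiv> the_inv_into (fst c) (snd c)"

text \<open>In a box \<open>(c, w, e)\<close> the centre \<open>w\<close> is given in the coordinates of \<open>c\<close>, and \<open>e\<close> is the radius of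
  the inner cube, hence half that of the outer one.\<close>

type_synonym 'a box = "'a chart \<times> (nat \<Rightarrow> real) \<times> real"

text \<open>The closed cube of the full outer radius has to fit into the chart image: its
  compactness gives the uniform metric bounds and makes smaller closed cubes closed in the whole
  manifold.\<close>

definition is_box :: "'a mfd \<Rightarrow> 'a box \<Rightarrow> bool" where
  "is_box M = (\<lambda>(c, w, e). c \<in> charts M \<and> 0 < e \<and> cube (mdim M) w (2 * e) \<subseteq> snd c ` fst c)"

definition inner_box :: "'a mfd \<Rightarrow> 'a box \<Rightarrow> 'a set" where
  "inner_box M = (\<lambda>(c, w, e). {x \<in> fst c. snd c x \<in> open_cube (mdim M) w e})"

definition outer_box :: "'a mfd \<Rightarrow> 'a box \<Rightarrow> 'a set" where
  "outer_box M = (\<lambda>(c, w, e). {x \<in> fst c. snd c x \<in> open_cube (mdim M) w (2 * e)})"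

section \<open>Charts and boxes of a smooth manifold\<close>

locale smooth_mfd =
  fixes M :: "'a mfd"
  assumes smooth: "smooth_manifold M"
begin

abbreviation "n \<equiv> mdim M"
abbreviation "X \<equiv> mtop M"

lemma Hausdorff: "Hausdorff_space X"
  using smooth by (simp add: modelled_on_def)

context
  fixes c assumes c: "c \<in> charts M"
begin

lemma openin_chart: "openin X (fst c)"
  and openin_chart_image: "openin (top_of_set (eucl n)) (snd c ` fst c)"
  and homeomorphic_map_chart:
    "homeomorphic_map (subtopology X (fst c)) (top_of_set (snd c ` fst c)) (snd c)"
  using smooth c by (auto simp: modelled_on_def chart_in_def)

lemma chart_subset: "fst c \<subseteq> topspace X"
  using openin_chart openin_subset by blast

lemma chart_image_subset: "snd c ` fst c \<subseteq> eucl n"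
  using openin_chart_image openin_subset by fastforce

lemma inj_on_chart: "inj_on (snd c) (fst c)"
  using homeomorphic_imp_injective_map[OF homeomorphic_map_chart] chart_subset
  by (simp add: Int_absorb1)

lemma continuous_map_chart: "continuous_map (subtopology X (fst c)) (top_of_set (snd c ` fst c)) (snd c)"
  using homeomorphic_map_chart homeomorphic_imp_continuous_map by blast

lemma chart_inv [simp]:
  "x \<in> fst c \<Longrightarrow> chart_inv c (snd c x) = x"
  "z \<in> snd c ` fst c \<Longrightarrow> snd c (chart_inv c z) = z"
  "z \<in> snd c ` fst c \<Longrightarrow> chart_inv c z \<in> fst c"
  using inj_on_chart
  by (simp_all add: the_inv_into_f_f f_the_inv_into_f the_inv_into_into)

lemma continuous_map_chart_inv: "continuous_map (top_of_set (snd c ` fst c)) X (chart_inv c)"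
proof -
  obtain g where g: "homeomorphic_maps (subtopology X (fst c)) (top_of_set (snd c ` fst c)) (snd c) g"
    using homeomorphic_map_chart by (auto simp: homeomorphic_map_maps)
  then have "continuous_map (top_of_set (snd c ` fst c)) X g"
    by (auto simp: homeomorphic_maps_def continuous_map_in_subtopology)
  moreover have "g z = chart_inv c z" if "z \<in> snd c ` fst c" for z
    using that g chart_subset by (auto simp: homeomorphic_maps_def)
  ultimately show ?thesis
    by (auto intro: continuous_map_eq)
qed

lemma openin_chart_preimage:
  assumes "openin (top_of_set (eucl n)) V"
  shows "openin X {x \<in> fst c. snd c x \<in> V}"
proof -
  have "openin (top_of_set (snd c ` fst c)) (snd c ` fst c \<inter> V)"
    using assms chart_image_subset by (auto simp: openin_open)
  then have "openin (subtopology X (fst c)) {x \<in> topspace (subtopology X (fst c)). snd c x \<in> snd c ` fst c \<inter> V}"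
    using continuous_map_chart openin_continuous_map_preimage by blast
  moreover have "{x \<in> topspace (subtopology X (fst c)). snd c x \<in> snd c ` fst c \<inter> V} = {x \<in> fst c. snd c x \<in> V}"
    using chart_subset by auto
  ultimately show ?thesis
    using openin_chart openin_trans_full by metis
qed

lemma openin_chart_image_of_openin:
  assumes "openin X V"
  shows "openin (top_of_set (eucl n)) (snd c ` (fst c \<inter> V))"
proof -
  have "openin (subtopology X (fst c)) (fst c \<inter> V)"
    using assms by (auto simp: openin_subtopology)
  then have "openin (top_of_set (snd c ` fst c)) (snd c ` (fst c \<inter> V))"
    using homeomorphic_map_openness_eq[OF homeomorphic_map_chart] by blast
  then show ?thesis
    using openin_chart_image openin_trans by blast
qed

text \<open>A set closed in a chart domain need not be closed in \<open>X\<close>. This one is the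
  image of a compact cube under the inverse chart, and \<open>X\<close> is Hausdorff.\<close>

lemma closedin_chart_cube:
  assumes "cube n w r \<subseteq> snd c ` fst c"
  shows "closedin X {x \<in> fst c. snd c x \<in> cube n w r}"
proof -
  have "compactin (top_of_set (snd c ` fst c)) (cube n w r)"
    using assms compact_cube by (simp add: compactin_subtopology)
  then have "compactin X (chart_inv c ` cube n w r)"
    using continuous_map_chart_inv image_compactin by blast
  moreover have "chart_inv c ` cube n w r = {x \<in> fst c. snd c x \<in> cube n w r}"
  proof (intro equalityI subsetI)
    fix x assume "x \<in> chart_inv c ` cube n w r"
    then obtain z where z: "z \<in> cube n w r" "x = chart_inv c z" by blast
    then show "x \<in> {x \<in> fst c. snd c x \<in> cube n w r}"
      using assms by auto
  next
    fix x assume "x \<in> {x \<in> fst c. snd c x \<in> cube n w r}"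
    then show "x \<in> chart_inv c ` cube n w r"
      by (intro image_eqI[of _ _ "snd c x"]) auto
  qed
  ultimately show ?thesis
    using Hausdorff compactin_imp_closedin by metis
qed

lemma pathin_chart_iff:
  assumes "p ` {0..1} \<subseteq> fst c"
  shows "pathin X p \<longleftrightarrow> continuous_on {0..1} (\<lambda>s. snd c (p s))"
proof
  assume "pathin X p"
  then have "continuous_map (top_of_set {0..1}) (subtopology X (fst c)) p"
    using assms by (auto simp: pathin_def continuous_map_in_subtopology)
  from continuous_map_compose[OF this continuous_map_chart]
  show "continuous_on {0..1} (\<lambda>s. snd c (p s))"
    by (simp add: o_def)
next
  assume "continuous_on {0..1} (\<lambda>s. snd c (p s))"
  then have "continuous_map (top_of_set {0..1}) (top_of_set (snd c ` fst c)) (\<lambda>s. snd c (p s))"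
    using assms by auto
  from continuous_map_compose[OF this continuous_map_chart_inv]
  show "pathin X p"
    unfolding pathin_def by (rule continuous_map_eq) (use assms in \<open>auto simp: image_subset_iff\<close>)
qed

text \<open>Cubes are convex, so straight lines in coordinates supply both the joining paths and the
  homotopies.\<close>

lemma path_simple_chart_cube:
  assumes w: "open_cube n w r \<subseteq> snd c ` fst c"
  shows "path_simple X {x \<in> fst c. snd c x \<in> open_cube n w r}" (is "path_simple X ?V")
  unfolding path_simple_def
proof (intro conjI ballI allI impI; (elim conjE)?)
  fix x y assume xy: "x \<in> ?V" "y \<in> ?V"
  let ?\<sigma> = "\<lambda>s i. (1 - s) * snd c x i + s * snd c y i"
  let ?p = "\<lambda>s. chart_inv c (?\<sigma> s)"
  have \<sigma>: "?\<sigma> s \<in> open_cube n w r" if "s \<in> {0..1}" for s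
    using open_cube_convex_combination xy that by auto
  have p: "?p s \<in> ?V" "snd c (?p s) = ?\<sigma> s" if "s \<in> {0..1}" for s
    using subsetD[OF w \<sigma>[OF that]] \<sigma>[OF that] by auto
  have "pathin X ?p"
  proof (subst pathin_chart_iff)
    show "?p ` {0..1} \<subseteq> fst c" using p by auto
    have "continuous_on {0..1} ?\<sigma>"
      by (intro continuous_on_coordinatewise_then_product continuous_intros)
    then show "continuous_on {0..1} (\<lambda>s. snd c (?p s))"
      by (rule continuous_on_eq) (simp add: p)
  qed
  then have "path_from_to X x y ?p"
    using xy by (simp add: path_from_to_def)
  then show "\<exists>p. path_from_to X x y p \<and> p ` {0..1} \<subseteq> ?V"
    using p by (intro exI[of _ ?p]) blast
next
  fix p q assume pq: "pathin X p" "pathin X q" "p ` {0..1} \<subseteq> ?V" "q ` {0..1} \<subseteq> ?V"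
    "p 0 = q 0" "p 1 = q 1"
  let ?\<sigma> = "\<lambda>z i. (1 - fst z) * snd c (p (snd z)) i + fst z * snd c (q (snd z)) i"
  have \<sigma>: "?\<sigma> z \<in> snd c ` fst c" if "z \<in> {0..1} \<times> {0..1}" for z
    using that pq(3,4) by (intro subsetD[OF w] open_cube_convex_combination) auto
  have "p ` {0..1} \<subseteq> fst c" "q ` {0..1} \<subseteq> fst c"
    using pq by auto
  then have "continuous_on {0..1} (\<lambda>s. snd c (p s))" "continuous_on {0..1} (\<lambda>s. snd c (q s))"
    using pq pathin_chart_iff by auto
  note cont = this[THEN continuous_on_product_then_coordinatewise]
  have "continuous_on ({0..1} \<times> {0..1}) (\<lambda>z. snd c (p (snd z)) i)"
    "continuous_on ({0..1} \<times> {0..1}) (\<lambda>z. snd c (q (snd z)) i)" for i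
    by (rule continuous_on_compose2[OF cont(1)] continuous_on_compose2[OF cont(2)];
        auto intro: continuous_on_snd continuous_on_id)+
  then have "continuous_on ({0..1} \<times> {0..1}) ?\<sigma>"
    by (intro continuous_on_coordinatewise_then_product continuous_on_add continuous_on_mult
        continuous_on_diff continuous_on_const continuous_on_fst continuous_on_id)
  then have "continuous_map (prod_topology (top_of_set {0..1}) (top_of_set {0..1}))
      (top_of_set (snd c ` fst c)) ?\<sigma>"
    using \<sigma> by (simp add: prod_topology_subtopology subtopology_subtopology Times_Int_Times image_subset_iff)
  then have "continuous_map (prod_topology (top_of_set {0..1}) (top_of_set {0..1})) X (chart_inv c \<circ> ?\<sigma>)"
    using continuous_map_chart_inv by (rule continuous_map_compose)
  then show "path_homotopic X p q"
    unfolding path_homotopic_iff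
    by (intro exI[of _ "chart_inv c \<circ> ?\<sigma>"] conjI) (use pq in \<open>auto simp: algebra_simps image_subset_iff\<close>)
qed

end

lemma openin_inner_box: "is_box M b \<Longrightarrow> openin X (inner_box M b)"
  by (auto simp: is_box_def inner_box_def intro!: openin_chart_preimage openin_open_cube)

lemma openin_outer_box: "is_box M b \<Longrightarrow> openin X (outer_box M b)"
  by (auto simp: is_box_def outer_box_def intro!: openin_chart_preimage openin_open_cube)

lemma path_simple_outer_box: "is_box M b \<Longrightarrow> path_simple X (outer_box M b)"
  unfolding is_box_def outer_box_def
  by (cases b) (auto intro!: path_simple_chart_cube dest: open_cube_subset_cube[OF order_refl, THEN subsetD])

lemma ex_box:
  assumes "openin X N" "x \<in> N"
  shows "\<exists>b. is_box M b \<and> x \<in> inner_box M b \<and> outer_box M b \<subseteq> N"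
proof -
  have "x \<in> topspace X"
    using assms openin_subset by blast
  then obtain c where c: "c \<in> charts M" "x \<in> fst c"
    using smooth by (auto simp: modelled_on_def)
  obtain r where r: "0 < r" "cube n (snd c x) r \<subseteq> snd c ` (fst c \<inter> N)"
    using ex_cube_subset[OF openin_chart_image_of_openin[OF c(1) assms(1)], of "snd c x"] c assms
    by blast
  let ?b = "(c, snd c x, r / 2)"
  have "is_box M ?b"
    using c r by (auto simp: is_box_def)
  moreover have "x \<in> inner_box M ?b"
    using c r chart_image_subset[OF c(1)] by (auto simp: inner_box_def open_cube_def)
  moreover have "outer_box M ?b \<subseteq> N"
  proof
    fix y assume "y \<in> outer_box M ?b"
    then have y: "y \<in> fst c" "snd c y \<in> snd c ` (fst c \<inter> N)"
      using subset_trans[OF open_cube_subset_cube[OF order_refl] r(2)] by (auto simp: outer_box_def)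
    then show "y \<in> N"
      using inj_on_chart[OF c(1)] by (auto dest: inj_onD)
  qed
  ultimately show ?thesis by blast
qed

end

section \<open>Finite box covers of a closed manifold\<close>

locale closed_mfd = smooth_mfd +
  assumes compact: "compact_space X"
begin

text \<open>Compactness is applied to the inner boxes, whereas it is the outer boxes that fit into
  the given neighbourhoods; the cover thus keeps a margin.\<close>

lemma ex_box_refinement:
  assumes N: "\<And>x. x \<in> topspace X \<Longrightarrow> openin X (N x) \<and> x \<in> N x"
  shows "\<exists>P. finite P \<and> (\<forall>b\<in>P. is_box M b \<and> (\<exists>x\<in>topspace X. outer_box M b \<subseteq> N x)) \<and>
    topspace X \<subseteq> (\<Union>b\<in>P. inner_box M b)"
proof -
  have "\<exists>b. is_box M b \<and> x \<in> inner_box M b \<and> outer_box M b \<subseteq> N x" if "x \<in> topspace X" for x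
    using ex_box N[OF that] by blast
  then obtain b where b: "\<And>x. x \<in> topspace X \<Longrightarrow> is_box M (b x) \<and> x \<in> inner_box M (b x) \<and> outer_box M (b x) \<subseteq> N x"
    by metis
  have "\<exists>\<F>. finite \<F> \<and> \<F> \<subseteq> (\<lambda>x. inner_box M (b x)) ` topspace X \<and> topspace X \<subseteq> \<Union>\<F>"
    by (rule compact[unfolded compact_space_alt, rule_format]) (use b openin_inner_box in auto)
  then obtain T where "finite T" "T \<subseteq> topspace X" "topspace X \<subseteq> (\<Union>x\<in>T. inner_box M (b x))"
    by (metis finite_subset_image)
  moreover have "is_box M d \<and> (\<exists>x\<in>topspace X. outer_box M d \<subseteq> N x)" if "d \<in> b ` T" for d
  proof -
    obtain x where "x \<in> T" "d = b x"
      using \<open>d \<in> b ` T\<close> by blast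
    then show ?thesis
      using b[of x] \<open>T \<subseteq> topspace X\<close> by auto
  qed
  ultimately show ?thesis
    by (intro exI[of _ "b ` T"]) auto
qed

text \<open>The boxes refine the neighbourhoods \<open>N x\<close>, which are chosen so that a point of \<open>N x\<close> lies in the
  closed inner box of \<open>b\<close> only if \<open>x\<close> does. Hence all refined boxes through \<open>z\<close> lie in the outer box
  of any \<open>b\<close> whose closed inner box contains \<open>z\<close>.\<close>

lemma ex_barycentric_box_cover:
  "\<exists>P. finite P \<and> (\<forall>b\<in>P. is_box M b) \<and> topspace X \<subseteq> (\<Union>b\<in>P. inner_box M b) \<and>
     (\<forall>b\<in>P. \<forall>b'\<in>P. outer_box M b \<inter> outer_box M b' \<noteq> {} \<longrightarrow>
        (\<exists>D. path_simple X D \<and> outer_box M b \<union> outer_box M b' \<subseteq> D))"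
proof -
  obtain Q where Q: "finite Q" "\<And>b. b \<in> Q \<Longrightarrow> is_box M b" "topspace X \<subseteq> (\<Union>b\<in>Q. inner_box M b)"
    using ex_box_refinement[of "\<lambda>x. topspace X"] by auto
  \<comment> \<open>The closed versions of the inner boxes: their complements are open, so that the
    finite intersection \<open>N x\<close> below is open.\<close>
  define C where "C = (\<lambda>(c :: 'a chart, w, e). {x \<in> fst c. snd c x \<in> cube n w e})"
  have closedC: "closedin X (C b)" "inner_box M b \<subseteq> C b" "C b \<subseteq> outer_box M b" if "b \<in> Q" for b
  proof -
    obtain c w e where b: "b = (c, w, e)" by (cases b)
    have *: "c \<in> charts M" "0 < e" "cube n w (2 * e) \<subseteq> snd c ` fst c"
      using Q(2)[OF that] by (auto simp: is_box_def b)
    have "cube n w e \<subseteq> open_cube n w (2 * e)" "cube n w e \<subseteq> cube n w (2 * e)"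
      using *(2) by (force simp: cube_def open_cube_def)+
    then show "closedin X (C b)" "inner_box M b \<subseteq> C b" "C b \<subseteq> outer_box M b"
      using * open_cube_subset_cube[of e e n w] closedin_chart_cube[OF *(1), of w e]
      by (auto simp: b C_def inner_box_def outer_box_def)
  qed
  define N where "N x = topspace X \<inter> (\<Inter>b\<in>Q. if x \<in> C b then outer_box M b else topspace X - C b)" for x
  have "openin X (N x) \<and> x \<in> N x" if "x \<in> topspace X" for x
  proof
    show "openin X (N x)"
    proof (cases "Q = {}")
      case False
      then show ?thesis
        unfolding N_def using Q(1,2) closedC
        by (intro openin_Int openin_INT2) (auto simp: openin_outer_box)
    qed (simp add: N_def)
    show "x \<in> N x"
      using that subsetD[OF closedC(3)] by (auto simp: N_def)
  qed
  then obtain P where P: "finite P" "\<And>b. b \<in> P \<Longrightarrow> is_box M b"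
      "\<And>b. b \<in> P \<Longrightarrow> \<exists>x\<in>topspace X. outer_box M b \<subseteq> N x" "topspace X \<subseteq> (\<Union>b\<in>P. inner_box M b)"
    using ex_box_refinement[of N] by blast
  have "\<exists>D. path_simple X D \<and> outer_box M b \<union> outer_box M b' \<subseteq> D"
    if "b \<in> P" "b' \<in> P" and meet: "outer_box M b \<inter> outer_box M b' \<noteq> {}" for b b'
  proof -
    obtain z where z: "z \<in> outer_box M b" "z \<in> outer_box M b'"
      using meet by blast
    then have "z \<in> topspace X"
      using openin_outer_box[OF P(2)[OF that(1)]] openin_subset by blast
    then obtain q where q: "q \<in> Q" "z \<in> C q"
      using Q(3) closedC(2) by blast
    have "outer_box M d \<subseteq> outer_box M q" if d: "d \<in> P" "z \<in> outer_box M d" for d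
    proof -
      obtain x where x: "x \<in> topspace X" "outer_box M d \<subseteq> N x"
        using P(3)[OF d(1)] by blast
      then have "z \<in> N x" using d(2) by blast
      then have "x \<in> C q"
        using q by (auto simp: N_def split: if_splits)
      then have "N x \<subseteq> outer_box M q"
        using q(1) by (auto simp: N_def)
      then show ?thesis using x by blast
    qed
    then show ?thesis
      using z that path_simple_outer_box[OF Q(2)[OF q(1)]] by blast
  qed
  then show ?thesis
    using P(1,2,4) by (intro exI[of _ P] conjI ballI impI) simp_all
qed

end

section \<open>Equicontinuity of isometries\<close>

lemma continuous_on_fun_upd: "continuous_on S (\<lambda>t. z(i := t))"
  for z :: "'i \<Rightarrow> 'b::topological_space"
proof (rule continuous_on_coordinatewise_then_product)
  show "continuous_on S (\<lambda>t. (z(i := t)) j)" for j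
    by (cases "j = i") auto
qed

text \<open>\<open>smooth_real\<close> provides only local extensions that agree with
  \<open>F\<close> on \<open>A\<close>. Since \<open>A\<close> is open in \<open>eucl n\<close>, the
  extension and \<open>F\<close> agree near \<open>z\<close> along the axis, so the derivative
  carries over.\<close>

lemma smooth_real_partial_derivative:
  assumes F: "smooth_real n A F" and A: "openin (top_of_set (eucl n)) A" and z: "z \<in> A" and i: "i < n"
  shows "\<exists>D. ((\<lambda>t. F (z(i := t))) has_real_derivative D) (at (z i))"
proof -
  obtain U f where U: "z \<in> U" "smooth_open n U f" and "\<forall>y\<in>A \<inter> U. f y = F y"
    using bspec[OF F[unfolded smooth_real_def] z] by blast
  then have eq: "f y = F y" if "y \<in> A \<inter> U" for y
    using that by blast
  obtain D where D: "((\<lambda>t. f (z(i := t))) has_real_derivative D) (at (z i))"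
    using U i unfolding smooth_open_def by blast
  have "openin (top_of_set (eucl n)) (A \<inter> U)"
    using A U by (auto simp: smooth_open_def)
  then obtain T where T: "open T" "A \<inter> U = eucl n \<inter> T"
    by (auto simp: openin_open)
  have "open ((\<lambda>t. z(i := t)) -` T)"
    using T(1) continuous_on_fun_upd by (rule open_vimage)
  moreover have "z i \<in> (\<lambda>t. z(i := t)) -` T"
    using z U(1) T(2) by auto
  moreover have "f (z(i := t)) = F (z(i := t))" if "t \<in> (\<lambda>t. z(i := t)) -` T" for t
  proof (rule eq)
    have "z \<in> eucl n" using z U(1) T(2) by blast
    then have "z(i := t) \<in> eucl n" using i by (auto simp: eucl_def)
    then show "z(i := t) \<in> A \<inter> U" using that T(2) by auto
  qed
  ultimately have "((\<lambda>t. F (z(i := t))) has_real_derivative D) (at (z i))"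
    by (rule has_field_derivative_transform_within_open[OF D])
  then show ?thesis ..
qed

lemma continuous_on_smooth_real:
  assumes F: "smooth_real n A F" and A: "A \<subseteq> eucl n"
  shows "continuous_on A F"
  unfolding continuous_on_eq_continuous_within
proof
  fix z assume z: "z \<in> A"
  obtain U f where U: "z \<in> U" "smooth_open n U f" and "\<forall>y\<in>A \<inter> U. f y = F y"
    using bspec[OF F[unfolded smooth_real_def] z] by blast
  then have eq: "f y = F y" if "y \<in> A \<inter> U" for y
    using that by blast
  have f: "continuous_on U f" and "openin (top_of_set (eucl n)) U"
    using U unfolding smooth_open_def by auto
  then obtain T where T: "open T" "U = eucl n \<inter> T"
    by (auto simp: openin_open)
  then have AT: "A \<inter> T = A \<inter> U" using A by blast
  have "continuous_on (A \<inter> T) f"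
    using continuous_on_subset[OF f] AT by blast
  then have "continuous_on (A \<inter> T) F"
    by (rule continuous_on_eq) (simp add: AT eq)
  then have "continuous (at z within A \<inter> T) F"
    using z U(1) T(2) by (simp add: continuous_on_eq_continuous_within)
  moreover have "at z within A \<inter> T = at z within A"
    using T U(1) by (intro at_within_nhd[of z T]) auto
  ultimately show "continuous (at z within A) F" by simp
qed

section \<open>Uniform bounds for the metric and for derivatives of isometries\<close>

locale closed_riemannian = closed_mfd +
  fixes g :: "'a metric_coeffs"
  assumes g: "riemannian_metric M g"
begin

definition isometric :: "('a \<Rightarrow> 'a) \<Rightarrow> bool" where
  "isometric f \<longleftrightarrow> smooth_map M (topspace X) M f \<and> preserves_metric M g f"

lemma continuous_map_isometric: "isometric f \<Longrightarrow> continuous_map X X f"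
  by (simp add: isometric_def smooth_map_def)

lemma continuous_on_metric_coeffs:
  assumes c: "c \<in> charts M" and ij: "i < n" "j < n"
  shows "continuous_on (snd c ` fst c) (\<lambda>z. g c (chart_inv c z) i j)"
  using g c ij chart_image_subset[OF c] unfolding riemannian_metric_def
  by (intro continuous_on_smooth_real[of n]) auto

text \<open>The diagonal coefficients are the squared lengths of the coordinate vectors, the only
  vectors along which maps get differentiated.\<close>

lemma metric_upper_bound:
  assumes c: "c \<in> charts M" and K: "cube n w r \<subseteq> snd c ` fst c"
  shows "\<exists>A>0. \<forall>y\<in>fst c. snd c y \<in> cube n w r \<longrightarrow> (\<forall>i<n. g c y i i \<le> A)"
proof -
  have "\<exists>A. \<forall>z\<in>cube n w r. \<bar>g c (chart_inv c z) i i\<bar> \<le> A" if "i < n" for i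
  proof -
    have "compact ((\<lambda>z. g c (chart_inv c z) i i) ` cube n w r)"
      using continuous_on_subset[OF continuous_on_metric_coeffs[OF c that that] K] compact_cube
      by (rule compact_continuous_image)
    then show ?thesis
      using compact_imp_bounded bounded_real by fastforce
  qed
  then obtain A where A: "\<And>i z. i < n \<Longrightarrow> z \<in> cube n w r \<Longrightarrow> \<bar>g c (chart_inv c z) i i\<bar> \<le> A i"
    by metis
  have "g c y i i \<le> 1 + (\<Sum>i<n. \<bar>A i\<bar>)" if "y \<in> fst c" "snd c y \<in> cube n w r" "i < n" for y i
  proof -
    have "\<bar>g c y i i\<bar> \<le> A i"
      using A[OF that(3,2)] that(1) chart_inv(1)[OF c] by simp
    moreover have "\<bar>A i\<bar> \<le> (\<Sum>i<n. \<bar>A i\<bar>)"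
      using that(3) by (intro member_le_sum) auto
    ultimately show ?thesis by linarith
  qed
  then show ?thesis
    by (intro exI[of _ "1 + (\<Sum>i<n. \<bar>A i\<bar>)"]) (auto intro!: add_pos_nonneg sum_nonneg)
qed

text \<open>The form is positive on the compact product of the cube with the unit sphere
  \<open>S\<close> of the maximum norm, hence bounded below there by a positive constant;
  homogeneity of degree two extends this to every \<open>v\<close>.\<close>

lemma metric_lower_bound:
  assumes c: "c \<in> charts M" and K: "cube n w r \<subseteq> snd c ` fst c"
  shows "\<exists>a>0. \<forall>y\<in>fst c. snd c y \<in> cube n w r \<longrightarrow>
    (\<forall>v. \<forall>k<n. a * (v k)\<^sup>2 \<le> (\<Sum>i<n. \<Sum>j<n. g c y i j * v i * v j))"
proof -
  define \<Phi> where "\<Phi> = (\<lambda>(z, v). \<Sum>i<n. \<Sum>j<n. g c (chart_inv c z) i j * v i * v j)"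
  define S where "S = cube n (\<lambda>_. 0) 1 \<inter> (\<Union>k<n. {v. \<bar>v k\<bar> = 1})"
  have "closed {v :: nat \<Rightarrow> real. \<bar>v k\<bar> = 1}" for k
    by (rule closed_Collect_eq[OF continuous_on_rabs[OF continuous_on_product_coordinates] continuous_on_const])
  then have "closed (\<Union>k<n. {v :: nat \<Rightarrow> real. \<bar>v k\<bar> = 1})"
    by (intro closed_UN) auto
  then have S: "compact S"
    unfolding S_def by (rule compact_Int_closed[OF compact_cube])
  have cont: "continuous_on (cube n w r \<times> S) \<Phi>"
    unfolding \<Phi>_def case_prod_unfold
  proof (intro continuous_on_sum continuous_on_mult)
    fix i j assume ij: "i \<in> {..<n}" "j \<in> {..<n}"
    show "continuous_on (cube n w r \<times> S) (\<lambda>x. g c (chart_inv c (fst x)) i j)"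
      by (rule continuous_on_compose2[OF continuous_on_metric_coeffs[OF c, of i j]])
        (use ij K in \<open>auto intro: continuous_on_fst continuous_on_id\<close>)
    show "continuous_on (cube n w r \<times> S) (\<lambda>x. snd x i)" for i
      by (rule continuous_on_product_then_coordinatewise) (intro continuous_on_snd continuous_on_id)
    then show "continuous_on (cube n w r \<times> S) (\<lambda>x. snd x j)" .
  qed
  have pos: "0 < \<Phi> (z, v)" if z: "z \<in> cube n w r" and v: "v \<in> S" for z v
  proof -
    have y: "chart_inv c z \<in> fst c"
      using z K chart_inv(3)[OF c] by blast
    obtain k where "k < n" "v k \<noteq> 0"
      using v by (force simp: S_def)
    moreover have "(\<exists>i<n. v i \<noteq> 0) \<longrightarrow> 0 < (\<Sum>i<n. \<Sum>j<n. g c (chart_inv c z) i j * v i * v j)"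
      using g c y unfolding riemannian_metric_def by blast
    ultimately show ?thesis
      by (auto simp: \<Phi>_def)
  qed
  have "\<exists>a>0. \<forall>z\<in>cube n w r. \<forall>v\<in>S. a \<le> \<Phi> (z, v)"
  proof (cases "cube n w r \<times> S = {}")
    case True
    then show ?thesis by (intro exI[of _ 1]) auto
  next
    case False
    then obtain p where p: "p \<in> cube n w r \<times> S" "\<And>q. q \<in> cube n w r \<times> S \<Longrightarrow> \<Phi> p \<le> \<Phi> q"
      using continuous_attains_inf[OF compact_Times[OF compact_cube S] _ cont] by blast
    then have "0 < \<Phi> p" using pos by (cases p) auto
    with p(2) show ?thesis by blast
  qed
  then obtain a where a: "0 < a" "\<And>z v. z \<in> cube n w r \<Longrightarrow> v \<in> S \<Longrightarrow> a \<le> \<Phi> (z, v)"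
    by blast
  have "a * (v k)\<^sup>2 \<le> (\<Sum>i<n. \<Sum>j<n. g c y i j * v i * v j)"
    if y: "y \<in> fst c" "snd c y \<in> cube n w r" and k: "k < n" for y v k
  proof -
    define m where "m = Max ((\<lambda>i. \<bar>v i\<bar>) ` {..<n})"
    have m: "\<bar>v i\<bar> \<le> m" if "i < n" for i
      using that by (auto simp: m_def)
    have "m \<in> (\<lambda>i. \<bar>v i\<bar>) ` {..<n}"
      unfolding m_def using k by (intro Max_in) auto
    then obtain l where l: "l < n" "m = \<bar>v l\<bar>" by auto
    show ?thesis
    proof (cases "m = 0")
      case True
      then have "v i = 0" if "i < n" for i using m[OF that] by simp
      then show ?thesis using k by simp
    next
      case False
      then have m0: "0 < m" using l by auto
      \<comment> \<open>Normalization by the maximum norm. As \<open>v\<close> is arbitrary beyond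
        \<open>n\<close>, it is also cut off there to land in \<open>eucl n\<close>.\<close>
      define u where "u = (\<lambda>i. if i < n then v i / m else 0)"
      have "u \<in> S"
        using m m0 l by (auto simp: S_def u_def cube_def eucl_def intro!: bexI[of _ l])
      then have "a \<le> \<Phi> (snd c y, u)" using a(2) y by blast
      also have "\<Phi> (snd c y, u) = (\<Sum>i<n. \<Sum>j<n. g c y i j * v i * v j) / m\<^sup>2"
        using y m0 by (simp add: \<Phi>_def u_def chart_inv(1)[OF c] sum_divide_distrib power2_eq_square)
      finally have "a * m\<^sup>2 \<le> (\<Sum>i<n. \<Sum>j<n. g c y i j * v i * v j)"
        using m0 by (simp add: field_simps)
      moreover have "(v k)\<^sup>2 \<le> m\<^sup>2"
        using m[OF k] m0 by (simp add: abs_le_square_iff[symmetric])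
      ultimately show ?thesis
        using a(1) by (meson mult_left_mono less_imp_le order_trans)
    qed
  qed
  with a(1) show ?thesis by blast
qed

text \<open>Invariance of the metric with both indices equal to \<open>i\<close> says that the
  \<open>i\<close>-th coordinate vector and its image, the \<open>i\<close>-th column of the
  Jacobian, have the same length. The square of that length is at most \<open>A\<close>, and at
  least \<open>a\<close> times the square of each component of the column.\<close>

lemma partial_derivative_bound:
  assumes f: "isometric f" and c: "c \<in> charts M" and d: "d \<in> charts M"
    and z: "z \<in> snd c ` fst c" and fz: "f (chart_inv c z) \<in> fst d" and ik: "i < n" "k < n"
    and A: "g c (chart_inv c z) i i \<le> A" and a: "0 < a"
    and low: "\<And>v k. k < n \<Longrightarrow>
      a * (v k)\<^sup>2 \<le> (\<Sum>i<n. \<Sum>j<n. g d (f (chart_inv c z)) i j * v i * v j)"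
  shows "\<exists>D. ((\<lambda>t. loc_rep c d f (z(i := t)) k) has_real_derivative D) (at (z i)) \<and> \<bar>D\<bar> \<le> sqrt (A / a)"
proof -
  \<comment> \<open>In coordinates this is the domain on which \<open>loc_rep c d f\<close> is
    smooth; continuity of \<open>f\<close> makes it open, which gives two-sided partial
    derivatives.\<close>
  let ?O = "{x \<in> fst c \<inter> topspace X. f x \<in> fst d}"
  have "openin X {x \<in> topspace X. f x \<in> fst d}"
    using openin_continuous_map_preimage[OF continuous_map_isometric[OF f] openin_chart[OF d]] .
  moreover have "fst c \<inter> {x \<in> topspace X. f x \<in> fst d} = ?O" by auto
  ultimately have O: "openin (top_of_set (eucl n)) (snd c ` ?O)"
    using openin_chart_image_of_openin[OF c, of "{x \<in> topspace X. f x \<in> fst d}"] by simp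
  have zO: "z \<in> snd c ` ?O"
    using z fz chart_subset[OF c] chart_inv(1)[OF c] by auto
  have sm: "smooth_real n (snd c ` ?O) (\<lambda>x. loc_rep c d f x k)" if "k < n" for k
    using f c d that by (auto simp: isometric_def smooth_map_def smooth_on_def)
  let ?J = "\<lambda>k. jacobian (loc_rep c d f) z k i"
  have D: "((\<lambda>t. loc_rep c d f (z(i := t)) k) has_real_derivative ?J k) (at (z i))" if "k < n" for k
    using smooth_real_partial_derivative[OF sm[OF that] O zO ik(1)]
    by (auto simp: jacobian_def DERIV_imp_deriv)
  have "g c (chart_inv c z) i i = (\<Sum>k<n. \<Sum>l<n. ?J k * ?J l * g d (f (chart_inv c z)) k l)"
    using f c d fz ik(1) chart_inv(2,3)[OF c z] by (auto simp: isometric_def preserves_metric_def)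
  also have "\<dots> = (\<Sum>k<n. \<Sum>l<n. g d (f (chart_inv c z)) k l * ?J k * ?J l)"
    by (simp add: ac_simps)
  finally have "a * (?J k)\<^sup>2 \<le> A"
    using low[OF ik(2), of ?J] A by simp
  then have "(?J k)\<^sup>2 \<le> A / a"
    using a by (simp add: field_simps)
  then have "\<bar>?J k\<bar> \<le> sqrt (A / a)"
    using real_le_rsqrt by (simp add: real_le_rsqrt)
  with D[OF ik(2)] show ?thesis by blast
qed

text \<open>The constant depends on the metric over the source cube and over the target box only, so
  one \<open>L\<close> serves all isometries. This uniformity is the source of
  equicontinuity.\<close>

lemma ex_partial_derivative_bound:
  assumes c: "c \<in> charts M" and K: "cube n z0 r \<subseteq> snd c ` fst c" and b: "is_box M b"
  shows "\<exists>L\<ge>0. \<forall>f z i k. isometric f \<longrightarrow> z \<in> cube n z0 r \<longrightarrow> f (chart_inv c z) \<in> outer_box M b \<longrightarrow> i < n \<longrightarrow> k < n \<longrightarrow>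
    (\<exists>D. ((\<lambda>t. loc_rep c (fst b) f (z(i := t)) k) has_real_derivative D) (at (z i)) \<and> \<bar>D\<bar> \<le> L)"
proof -
  obtain d w e where b_eq: "b = (d, w, e)" by (cases b)
  have d: "d \<in> charts M" "0 < e" "cube n w (2 * e) \<subseteq> snd d ` fst d"
    using b by (auto simp: is_box_def b_eq)
  obtain A where A: "0 < A" "\<And>y i. y \<in> fst c \<Longrightarrow> snd c y \<in> cube n z0 r \<Longrightarrow> i < n \<Longrightarrow> g c y i i \<le> A"
    using metric_upper_bound[OF c K] by blast
  obtain a where a: "0 < a" "\<And>y v k. y \<in> fst d \<Longrightarrow> snd d y \<in> cube n w (2 * e) \<Longrightarrow> k < n \<Longrightarrow>
      a * (v k)\<^sup>2 \<le> (\<Sum>i<n. \<Sum>j<n. g d y i j * v i * v j)"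
    using metric_lower_bound[OF d(1,3)] by blast
  show ?thesis
  proof (rule exI[of _ "sqrt (A / a)"], intro conjI allI impI)
    fix f z i k
    assume *: "isometric f" "z \<in> cube n z0 r" "f (chart_inv c z) \<in> outer_box M b" "i < n" "k < n"
    have z: "z \<in> snd c ` fst c" using * K by blast
    have fz: "f (chart_inv c z) \<in> fst d" "snd d (f (chart_inv c z)) \<in> cube n w (2 * e)"
      using *(3) open_cube_subset_cube[OF order_refl] by (auto simp: outer_box_def b_eq dest: subsetD)
    have "g c (chart_inv c z) i i \<le> A"
      using A(2)[of "chart_inv c z" i] chart_inv(2,3)[OF c z] * by simp
    then show "\<exists>D. ((\<lambda>t. loc_rep c (fst b) f (z(i := t)) k) has_real_derivative D) (at (z i)) \<and> \<bar>D\<bar> \<le> sqrt (A / a)"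
      using partial_derivative_bound[OF *(1) c d(1) z fz(1) *(4,5) _ a(1) a(2)[OF fz]]
      by (auto simp: b_eq)
  qed (use A a in auto)
qed

text \<open>Moving along one coordinate axis at a time needs only partial derivatives, so that no chain rule
  for the maps \<^const>\<open>loc_rep\<close> enters. The bound on the derivative is available only while the image
  stays in the outer box, so leaving the box has to be excluded at the first exit time.\<close>

lemma coordinate_step:
  assumes f: "continuous_map X X f" and c: "c \<in> charts M" and K: "cube n z0 r \<subseteq> snd c ` fst c"
    and b: "is_box M (d, w, e)" and L: "0 \<le> L" and i: "i < n"
    and deriv: "\<And>z k. z \<in> cube n z0 r \<Longrightarrow> f (chart_inv c z) \<in> outer_box M (d, w, e) \<Longrightarrow> k < n \<Longrightarrow>
      \<exists>D. ((\<lambda>t. loc_rep c d f (z(i := t)) k) has_real_derivative D) (at (z i)) \<and> \<bar>D\<bar> \<le> L"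
    and z: "z \<in> cube n z0 r" "z(i := s) \<in> cube n z0 r"
    and fz: "f (chart_inv c z) \<in> fst d" "\<And>k. k < n \<Longrightarrow> \<bar>snd d (f (chart_inv c z)) k - w k\<bar> \<le> \<rho>"
    and \<rho>: "\<rho> + L * \<bar>s - z i\<bar> < 2 * e"
  shows "f (chart_inv c (z(i := s))) \<in> fst d \<and>
    (\<forall>k<n. \<bar>snd d (f (chart_inv c (z(i := s)))) k - snd d (f (chart_inv c z)) k\<bar> \<le> L * \<bar>s - z i\<bar>)"
proof -
  define \<delta> where "\<delta> = s - z i"
  define \<zeta> where "\<zeta> t = z(i := z i + t * \<delta>)" for t
  define \<phi> where "\<phi> t = f (chart_inv c (\<zeta> t))" for t
  define \<psi> where "\<psi> t = snd d (\<phi> t)" for t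
  let ?V = "outer_box M (d, w, e)"
  have d: "d \<in> charts M" "0 < e" "cube n w (2 * e) \<subseteq> snd d ` fst d"
    using b by (auto simp: is_box_def)
  have \<zeta>01: "\<zeta> 0 = z" "\<zeta> 1 = z(i := s)"
    by (auto simp: \<zeta>_def \<delta>_def)
  have \<zeta>: "\<zeta> t \<in> cube n z0 r" if "t \<in> {0..1}" for t
  proof -
    have "(1 - t) *\<^sub>R z i + t *\<^sub>R s \<in> cball (z0 i) r"
      using z i that by (intro convexD[OF convex_cball]) (auto simp: cube_def dist_real_def split: if_splits)
    then have "\<bar>z i + t * \<delta> - z0 i\<bar> \<le> r"
      by (simp add: dist_real_def \<delta>_def algebra_simps abs_minus_commute)
    then show ?thesis
      using z i by (auto simp: cube_def eucl_def \<zeta>_def)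
  qed
  have cont: "pathin X \<phi>"
  proof -
    have "continuous_on {0..1} (\<lambda>t. z i + t * \<delta>)" by (intro continuous_intros)
    then have "continuous_on {0..1} \<zeta>"
      unfolding \<zeta>_def by (rule continuous_on_compose2[OF continuous_on_fun_upd[of UNIV z i]]) auto
    then have "continuous_map (top_of_set {0..1}) (top_of_set (snd c ` fst c)) \<zeta>"
      using \<zeta> K by auto
    from continuous_map_compose[OF continuous_map_compose[OF this continuous_map_chart_inv[OF c]] f]
    show ?thesis unfolding pathin_def \<phi>_def[abs_def] o_def .
  qed
  \<comment> \<open>An a priori estimate: it presupposes that the path has not left the box up to
    time \<open>t\<close>.\<close>
  have mvt: "\<bar>\<psi> t k - \<psi> 0 k\<bar> \<le> L * \<bar>\<delta>\<bar>"
    if t: "t \<in> {0..1}" and V: "\<And>t'. t' \<in> {0..t} \<Longrightarrow> \<phi> t' \<in> ?V" and k: "k < n" for t k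
  proof -
    have "\<exists>D. ((\<lambda>t. \<psi> t k) has_real_derivative D) (at t' within {0..t}) \<and> \<bar>D\<bar> \<le> L * \<bar>\<delta>\<bar>"
      if t': "t' \<in> {0..t}" for t'
    proof -
      have "\<zeta> t' \<in> cube n z0 r" using \<zeta> t t' by auto
      then obtain D where D: "((\<lambda>u. loc_rep c d f ((\<zeta> t')(i := u)) k) has_real_derivative D) (at (\<zeta> t' i))"
          "\<bar>D\<bar> \<le> L"
        using deriv[of "\<zeta> t'" k] V[OF t'] k by (auto simp: \<phi>_def)
      have "((\<lambda>t. z i + t * \<delta>) has_real_derivative \<delta>) (at t')"
        by (auto intro!: derivative_eq_intros)
      moreover have "((\<lambda>u. loc_rep c d f (z(i := u)) k) has_real_derivative D) (at (z i + t' * \<delta>))"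
        using D(1) by (simp add: \<zeta>_def)
      ultimately have "((\<lambda>t. loc_rep c d f (z(i := z i + t * \<delta>)) k) has_real_derivative D * \<delta>) (at t')"
        using DERIV_chain2 by fast
      then have "((\<lambda>t. \<psi> t k) has_real_derivative D * \<delta>) (at t')"
        by (simp add: \<psi>_def \<phi>_def \<zeta>_def loc_rep_def)
      moreover have "\<bar>D * \<delta>\<bar> \<le> L * \<bar>\<delta>\<bar>"
        using D(2) by (simp add: abs_mult mult_right_mono)
      ultimately show ?thesis
        using has_field_derivative_at_within by blast
    qed
    then obtain D where "\<And>t'. t' \<in> {0..t} \<Longrightarrow>
        ((\<lambda>t. \<psi> t k) has_real_derivative D t') (at t' within {0..t}) \<and> \<bar>D t'\<bar> \<le> L * \<bar>\<delta>\<bar>"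
      by metis
    then have "norm (\<psi> t k - \<psi> 0 k) \<le> L * \<bar>\<delta>\<bar> * norm (t - 0)"
      using t by (intro field_differentiable_bound[of "{0..t}" _ D]) auto
    also have "\<dots> \<le> L * \<bar>\<delta>\<bar> * 1"
      using t L by (intro mult_left_mono) auto
    finally show ?thesis by simp
  qed
  \<comment> \<open>While the path stays in \<open>?V\<close>, the estimate confines it to this
    smaller set, which is closed in \<open>X\<close>. So at a first exit time, a limit of earlier
    times, the path would still lie in \<open>?C\<close> and hence in \<open>?V\<close>.\<close>
  let ?C = "{x \<in> fst d. snd d x \<in> cube n w (\<rho> + L * \<bar>\<delta>\<bar>)}"
  have \<rho>': "\<rho> + L * \<bar>\<delta>\<bar> < 2 * e" using \<rho> by (simp add: \<delta>_def)
  have CV: "?C \<subseteq> ?V"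
    using \<rho>' by (force simp: outer_box_def cube_def open_cube_def)
  have "cube n w (\<rho> + L * \<bar>\<delta>\<bar>) \<subseteq> cube n w (2 * e)"
    using \<rho>' by (force simp: cube_def)
  then have closedC: "closedin X ?C"
    using closedin_chart_cube[OF d(1)] d(3) by blast
  have \<phi>C: "\<phi> t \<in> ?C" if t: "t \<in> {0..1}" and V: "\<And>t'. t' \<in> {0..t} \<Longrightarrow> \<phi> t' \<in> ?V" for t
  proof -
    have "\<phi> t \<in> ?V" using V t by auto
    then have *: "\<phi> t \<in> fst d" "\<psi> t \<in> eucl n"
      by (auto simp: outer_box_def open_cube_def \<psi>_def)
    have "\<bar>\<psi> t k - w k\<bar> \<le> \<rho> + L * \<bar>\<delta>\<bar>" if "k < n" for k
      using mvt[OF t V that] fz(2)[OF that] by (simp add: \<psi>_def \<phi>_def \<zeta>01)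
    with * show ?thesis by (auto simp: cube_def \<psi>_def)
  qed
  have \<phi>0: "\<phi> 0 \<in> ?V"
  proof -
    have "\<bar>snd d (\<phi> 0) k - w k\<bar> < 2 * e" if "k < n" for k
    proof -
      have "0 \<le> L * \<bar>\<delta>\<bar>" using L by simp
      then show ?thesis
        using fz(2)[OF that] \<rho>' unfolding \<phi>_def \<zeta>01 by linarith
    qed
    then show ?thesis
      using fz(1) chart_image_subset[OF d(1)] by (auto simp: outer_box_def open_cube_def \<phi>_def \<zeta>01)
  qed
  have all: "\<phi> t \<in> ?V" if "t \<in> {0..1}" for t
  proof (rule ccontr)
    assume "\<phi> t \<notin> ?V"
    define K where "K = {t \<in> {0..1}. \<phi> t \<notin> ?V}"
    have "openin (top_of_set {0..1}) {t \<in> {0..1}. \<phi> t \<in> ?V}"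
      using openin_continuous_map_preimage[OF cont[unfolded pathin_def] openin_outer_box[OF b]] by simp
    then have "closedin (top_of_set {0..1}) ({0..1} - {t \<in> {0..1}. \<phi> t \<in> ?V})"
      by (simp add: closedin_diff)
    moreover have "{0..1} - {t \<in> {0..1}. \<phi> t \<in> ?V} = K" by (auto simp: K_def)
    ultimately have "compact K"
      using closedin_compact[OF compact_Icc] by metis
    moreover have "K \<noteq> {}" using that \<open>\<phi> t \<notin> ?V\<close> by (auto simp: K_def)
    ultimately obtain t0 where t0: "t0 \<in> K" "\<And>t. t \<in> K \<Longrightarrow> t0 \<le> t"
      using compact_attains_inf[of K] by blast
    have t01: "t0 \<in> {0..1}" "t0 \<noteq> 0" using t0(1) \<phi>0 by (auto simp: K_def)
    have before: "\<phi> t' \<in> ?V" if "t' \<in> {0..<t0}" for t'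
      using t0(2)[of t'] that t01 by (auto simp: K_def)
    have "closedin (top_of_set {0..1}) {t \<in> {0..1}. \<phi> t \<in> ?C}"
      using closedin_continuous_map_preimage[OF cont[unfolded pathin_def] closedC] by simp
    then have "closed {t \<in> {0..1}. \<phi> t \<in> ?C}"
      using closedin_closed_trans closed_atLeastAtMost by blast
    moreover have "{0..<t0} \<subseteq> {t \<in> {0..1}. \<phi> t \<in> ?C}"
    proof
      fix t' assume t': "t' \<in> {0..<t0}"
      then have "t' \<in> {0..1}" using t01 by auto
      moreover have "\<phi> t' \<in> ?C" by (rule \<phi>C) (use t' t01 before in auto)
      ultimately show "t' \<in> {t \<in> {0..1}. \<phi> t \<in> ?C}" by blast
    qed
    ultimately have "closure {0..<t0} \<subseteq> {t \<in> {0..1}. \<phi> t \<in> ?C}"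
      by (rule closure_minimal[rotated])
    moreover have "t0 \<in> closure {0..<t0}"
      using t01 by (subst closure_atLeastLessThan) auto
    ultimately have "\<phi> t0 \<in> ?V" using CV by blast
    then show False using t0(1) by (simp add: K_def)
  qed
  then have "\<phi> 1 \<in> fst d" by (force simp: outer_box_def)
  moreover have "\<bar>\<psi> 1 k - \<psi> 0 k\<bar> \<le> L * \<bar>\<delta>\<bar>" if "k < n" for k
    by (rule mvt) (use all that in auto)
  ultimately show ?thesis
    by (simp add: \<psi>_def \<phi>_def \<zeta>01 \<delta>_def)
qed

text \<open>The box that receives \<open>B\<close> depends on \<open>f\<close>, but \<open>P\<close>
  is finite, so the least of finitely many radii works for all \<open>f\<close> at once. A point of
  \<open>B\<close> is reached from \<open>x\<close> in \<open>n\<close> steps along the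
  axes.\<close>

lemma isometries_equicontinuous:
  assumes P: "finite P" "\<And>b. b \<in> P \<Longrightarrow> is_box M b" "topspace X \<subseteq> (\<Union>b\<in>P. inner_box M b)"
    and x: "x \<in> topspace X"
  shows "\<exists>B. openin X B \<and> x \<in> B \<and> (\<forall>f. isometric f \<longrightarrow> (\<exists>b\<in>P. f ` B \<subseteq> outer_box M b))"
proof -
  obtain c where c: "c \<in> charts M" "x \<in> fst c"
    using smooth x by (auto simp: modelled_on_def)
  define z0 where "z0 = snd c x"
  have z0: "z0 \<in> snd c ` fst c" "z0 \<in> eucl n" "chart_inv c z0 = x"
    using c chart_image_subset[OF c(1)] chart_inv(1)[OF c(1)] by (auto simp: z0_def)
  obtain r where r: "0 < r" "cube n z0 r \<subseteq> snd c ` fst c"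
    using ex_cube_subset[OF openin_chart_image[OF c(1)] z0(1)] by blast
  have "\<exists>L\<ge>0. \<forall>f z i k. isometric f \<longrightarrow> z \<in> cube n z0 r \<longrightarrow> f (chart_inv c z) \<in> outer_box M b \<longrightarrow> i < n \<longrightarrow> k < n \<longrightarrow>
    (\<exists>D. ((\<lambda>t. loc_rep c (fst b) f (z(i := t)) k) has_real_derivative D) (at (z i)) \<and> \<bar>D\<bar> \<le> L)"
    if "b \<in> P" for b
    using ex_partial_derivative_bound[OF c(1) r(2) P(2)[OF that]] .
  then obtain L where L: "\<And>b. b \<in> P \<Longrightarrow> 0 \<le> L b"
    "\<And>b f z i k. \<lbrakk>b \<in> P; isometric f; z \<in> cube n z0 r; f (chart_inv c z) \<in> outer_box M b; i < n; k < n\<rbrakk> \<Longrightarrow>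
      \<exists>D. ((\<lambda>t. loc_rep c (fst b) f (z(i := t)) k) has_real_derivative D) (at (z i)) \<and> \<bar>D\<bar> \<le> L b"
    by metis
  \<comment> \<open>The bound \<open>r\<close> keeps the motion in the source cube. The quotients
    ensure that \<open>n\<close> steps of length at most \<delta> displace the image by less than
    the gap between inner and outer cube; the summand \<open>1\<close> keeps the denominator
    positive and the inequality strict.\<close>
  define \<delta> where "\<delta> = Min (insert r ((\<lambda>b. snd (snd b) / (n * L b + 1)) ` P))"
  have nL: "0 < n * L b + 1" if "b \<in> P" for b
    using L(1)[OF that] by (auto intro: add_nonneg_pos)
  have e: "0 < snd (snd b)" if "b \<in> P" for b
    using P(2)[OF that] by (auto simp: is_box_def)
  have \<delta>: "0 < \<delta>" "\<delta> \<le> r" "\<And>b. b \<in> P \<Longrightarrow> \<delta> \<le> snd (snd b) / (n * L b + 1)"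
    using P(1) r(1) nL e by (auto simp: \<delta>_def)
  have \<delta>e: "n * L b * \<delta> < snd (snd b)" if "b \<in> P" for b
  proof -
    have "(n * L b + 1) * \<delta> \<le> snd (snd b)"
      using \<delta>(3)[OF that] nL[OF that] by (simp add: field_simps)
    then show ?thesis using \<delta>(1) by (simp add: algebra_simps)
  qed
  define B where "B = {y \<in> fst c. snd c y \<in> open_cube n z0 \<delta>}"
  have "openin X B"
    unfolding B_def by (intro openin_chart_preimage c openin_open_cube)
  moreover have "x \<in> B"
    using c z0 \<delta>(1) by (simp add: B_def open_cube_def flip: z0_def)
  moreover have "\<exists>b\<in>P. f ` B \<subseteq> outer_box M b" if f: "isometric f" for f
  proof -
    have "f x \<in> topspace X"
      using continuous_map_isometric[OF f] x by (auto simp: continuous_map_def)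
    then obtain b where b: "b \<in> P" "f x \<in> inner_box M b"
      using P(3) by blast
    obtain d w e where b_eq: "b = (d, w, e)" by (cases b)
    have fx: "f x \<in> fst d" "\<And>k. k < n \<Longrightarrow> \<bar>snd d (f x) k - w k\<bar> < e"
      using b(2) by (auto simp: inner_box_def open_cube_def b_eq)
    have d: "d \<in> charts M"
      using P(2)[OF b(1)] by (simp add: is_box_def b_eq)
    have Lb: "0 \<le> L b" using L(1) b(1) by blast
    have "f y \<in> outer_box M b" if y: "y \<in> B" for y
    proof -
      define u where "u = snd c y"
      have u: "u \<in> eucl n" "\<And>i. i < n \<Longrightarrow> \<bar>u i - z0 i\<bar> < \<delta>" "chart_inv c u = y"
        using y chart_inv(1)[OF c(1)] by (auto simp: B_def open_cube_def u_def)
      \<comment> \<open>The staircase from \<open>z0\<close> to \<open>u\<close>: after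
        \<open>m\<close> steps the first \<open>m\<close> coordinates have been replaced.\<close>
      define p where "p m = (\<lambda>i. if i < m then u i else z0 i)" for m
      have p: "p m \<in> cube n z0 r" for m
        using u z0(2) \<delta>(1,2) r(1) by (force simp: p_def cube_def eucl_def)
      have "f (chart_inv c (p m)) \<in> fst d \<and>
          (\<forall>k<n. \<bar>snd d (f (chart_inv c (p m))) k - snd d (f x) k\<bar> \<le> m * (L b * \<delta>))" if "m \<le> n" for m
        using that
      proof (induction m)
        case 0
        then show ?case using fx(1) z0(3) by (simp add: p_def)
      next
        case (Suc m)
        then have m: "m < n" and IH: "f (chart_inv c (p m)) \<in> fst d"
          "\<And>k. k < n \<Longrightarrow> \<bar>snd d (f (chart_inv c (p m))) k - snd d (f x) k\<bar> \<le> m * (L b * \<delta>)"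
          by auto
        have pSuc: "p (Suc m) = (p m)(m := u m)"
          by (auto simp: p_def fun_eq_iff less_Suc_eq)
        have um: "\<bar>u m - p m m\<bar> \<le> \<delta>"
          using u(2)[OF m] by (simp add: p_def)
        then have step: "L b * \<bar>u m - p m m\<bar> \<le> L b * \<delta>"
          using Lb by (rule mult_left_mono)
        have "real (Suc m) * (L b * \<delta>) \<le> n * (L b * \<delta>)"
          using m Lb \<delta>(1) by (intro mult_right_mono) auto
        then have le: "m * (L b * \<delta>) + L b * \<delta> < e"
          using \<delta>e[OF b(1)] by (simp add: b_eq algebra_simps)
        have "f (chart_inv c ((p m)(m := u m))) \<in> fst d \<and>
          (\<forall>k<n. \<bar>snd d (f (chart_inv c ((p m)(m := u m)))) k - snd d (f (chart_inv c (p m))) k\<bar>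
             \<le> L b * \<bar>u m - p m m\<bar>)"
        \<comment> \<open>The last argument is the distance from the centre before the step:
          \<open>e\<close> for the inner box plus the drift of \<open>m\<close> earlier
          steps.\<close>
        proof (rule coordinate_step[OF continuous_map_isometric[OF f] c(1) r(2), of d w e "L b" m "p m" "u m" "m * (L b * \<delta>) + e"])
          show "is_box M (d, w, e)" using P(2)[OF b(1)] by (simp add: b_eq)
          show "\<exists>D. ((\<lambda>t. loc_rep c d f (z(m := t)) k) has_real_derivative D) (at (z m)) \<and> \<bar>D\<bar> \<le> L b"
            if "z \<in> cube n z0 r" "f (chart_inv c z) \<in> outer_box M (d, w, e)" "k < n" for z k
            using L(2)[OF b(1) f that(1) _ m that(3)] that(2) by (simp add: b_eq)
          show "(p m)(m := u m) \<in> cube n z0 r" using p[of "Suc m"] by (simp add: pSuc)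
          show "\<bar>snd d (f (chart_inv c (p m))) k - w k\<bar> \<le> m * (L b * \<delta>) + e" if "k < n" for k
            using IH(2)[OF that] fx(2)[OF that] by linarith
          show "m * (L b * \<delta>) + e + L b * \<bar>u m - p m m\<bar> < 2 * e"
            using step le by linarith
        qed (use Lb m p IH in auto)
        then have *: "f (chart_inv c (p (Suc m))) \<in> fst d"
          "\<And>k. k < n \<Longrightarrow> \<bar>snd d (f (chart_inv c (p (Suc m)))) k - snd d (f (chart_inv c (p m))) k\<bar>
             \<le> L b * \<bar>u m - p m m\<bar>"
          by (auto simp: pSuc)
        have "\<bar>snd d (f (chart_inv c (p (Suc m)))) k - snd d (f x) k\<bar> \<le> real (Suc m) * (L b * \<delta>)" if "k < n" for k
        proof -
          have "real (Suc m) * (L b * \<delta>) = m * (L b * \<delta>) + L b * \<delta>"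
            by (simp add: algebra_simps)
          then show ?thesis
            using *(2)[OF that] IH(2)[OF that] step by linarith
        qed
        with *(1) show ?case by blast
      qed
      moreover have "p n = u"
        using u(1) z0(2) by (auto simp: p_def eucl_def fun_eq_iff)
      ultimately have fy: "f y \<in> fst d" "\<And>k. k < n \<Longrightarrow> \<bar>snd d (f y) k - snd d (f x) k\<bar> \<le> n * (L b * \<delta>)"
        using u(3) by auto
      have "\<bar>snd d (f y) k - w k\<bar> < 2 * e" if "k < n" for k
        using fy(2)[OF that] fx(2)[OF that] \<delta>e[OF b(1)] by (simp add: b_eq algebra_simps)
      then show ?thesis
        using fy(1) chart_image_subset[OF d] by (auto simp: outer_box_def open_cube_def b_eq)
    qed
    with b(1) show ?thesis by blast
  qed
  ultimately show ?thesis by blast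
qed

end

section \<open>Nearby maps have the same outer action\<close>

text \<open>Short paths \<open>\<gamma> x\<close> from \<open>f x\<close> to \<open>h x\<close> are unique up to homotopy, so they form a
  natural transformation between the functors that \<open>f\<close> and \<open>h\<close> induce on fundamental groupoids.\<close>

lemma outer_action_subset_of_close:
  fixes f h :: "'a \<Rightarrow> 'a"
  assumes f: "continuous_map X X f" and h: "continuous_map X X h" and x0: "x0 \<in> topspace X"
    and B: "\<And>\<beta>. \<beta> \<in> I \<Longrightarrow> openin X (B \<beta>)" "topspace X \<subseteq> (\<Union>\<beta>\<in>I. B \<beta>)"
    and V: "\<And>\<beta>. \<beta> \<in> I \<Longrightarrow> path_simple X (V \<beta>)"
      "\<And>\<beta> x. \<beta> \<in> I \<Longrightarrow> x \<in> B \<beta> \<Longrightarrow> f x \<in> V \<beta> \<and> h x \<in> V \<beta>"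
      "\<And>\<beta> \<beta>'. \<beta> \<in> I \<Longrightarrow> \<beta>' \<in> I \<Longrightarrow> V \<beta> \<inter> V \<beta>' \<noteq> {} \<Longrightarrow> \<exists>D. path_simple X D \<and> V \<beta> \<union> V \<beta>' \<subseteq> D"
  shows "outer_action X x0 f \<subseteq> outer_action X x0 h"
proof -
  have join: "\<exists>p. path_from_to X (f x) (h x) p \<and> p ` {0..1} \<subseteq> V \<beta>" if "\<beta> \<in> I" "x \<in> B \<beta>" for \<beta> x
    using V(1)[OF that(1)] V(2)[OF that] unfolding path_simple_def by blast
  have "\<exists>p \<beta>. \<beta> \<in> I \<and> x \<in> B \<beta> \<and> path_from_to X (f x) (h x) p \<and> p ` {0..1} \<subseteq> V \<beta>"
    if "x \<in> topspace X" for x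
    using that B(2) join by blast
  then obtain \<gamma> i where \<gamma>: "\<And>x. x \<in> topspace X \<Longrightarrow>
      i x \<in> I \<and> x \<in> B (i x) \<and> path_from_to X (f x) (h x) (\<gamma> x) \<and> \<gamma> x ` {0..1} \<subseteq> V (i x)"
    by metis
  have \<gamma>': "pathin X (\<gamma> x)" "\<gamma> x 0 = f x" "\<gamma> x 1 = h x" if "x \<in> topspace X" for x
    using \<gamma>[OF that] by (auto simp: path_from_to_def)
  \<comment> \<open>The chosen path and \<open>p\<close> may run in different sets of the family.
    Both sets contain \<open>f x\<close>, so they meet and lie in a common path-simple set.\<close>
  have uniq: "path_homotopic X (\<gamma> x) p"
    if x: "x \<in> topspace X" and \<beta>: "\<beta> \<in> I" "x \<in> B \<beta>"
      and p: "path_from_to X (f x) (h x) p" "p ` {0..1} \<subseteq> V \<beta>" for x \<beta> p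
  proof -
    have "V (i x) \<inter> V \<beta> \<noteq> {}"
      using V(2)[OF \<beta>] V(2)[of "i x" x] \<gamma>[OF x] by blast
    then obtain D where D: "path_simple X D" "V (i x) \<union> V \<beta> \<subseteq> D"
      using V(3)[of "i x" \<beta>] \<gamma>[OF x] \<beta> by blast
    have "\<gamma> x ` {0..1} \<subseteq> D" "p ` {0..1} \<subseteq> D"
      using \<gamma>[OF x] p D(2) by blast+
    then show ?thesis
      using D(1) \<gamma>'[OF x] p(1) unfolding path_simple_def path_from_to_def by metis
  qed
  have natural: "path_homotopic X (path_join (\<lambda>t. f (r t)) (\<gamma> (r 1))) (path_join (\<gamma> (r 0)) (\<lambda>t. h (r t)))"
    if r: "pathin X r" for r
  proof -
    let ?f = "\<lambda>t. f (r t)" and ?h = "\<lambda>t. h (r t)"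
    have fr: "pathin X ?f" and hr: "pathin X ?h"
      using pathin_compose[OF r f] pathin_compose[OF r h] by (simp_all add: o_def)
    have rX: "r t \<in> topspace X" if "t \<in> {0..1}" for t
      using path_image_subset_topspace[OF r] that by auto
    define Q where "Q a b \<longleftrightarrow> path_homotopic X (path_join (subpath_of ?f a b) (\<gamma> (r b)))
        (path_join (\<gamma> (r a)) (subpath_of ?h a b))" for a b
    \<comment> \<open>Naturality is proved by bisection: it is additive over adjacent intervals and
      holds on short ones. The guards are there because the short intervals around a point may stick
      out of the unit interval.\<close>
    have "0 \<le> (0::real) \<and> 0 \<le> (1::real) \<and> (1::real) \<le> 1 \<longrightarrow> Q 0 1"
    proof (rule Bolzano[where P = "\<lambda>a b. 0 \<le> a \<and> a \<le> b \<and> b \<le> 1 \<longrightarrow> Q a b"])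
      fix a b c :: real
      assume ab: "0 \<le> a \<and> a \<le> b \<and> b \<le> 1 \<longrightarrow> Q a b" and bc: "0 \<le> b \<and> b \<le> c \<and> c \<le> 1 \<longrightarrow> Q b c"
        and le: "a \<le> b" "b \<le> c"
      show "0 \<le> a \<and> a \<le> c \<and> c \<le> 1 \<longrightarrow> Q a c"
      proof
        assume ac: "0 \<le> a \<and> a \<le> c \<and> c \<le> 1"
        then have Q: "Q a b" "Q b c"
          using ab bc le by auto
        have [simp]: "pathin X (\<gamma> (r a))" "pathin X (\<gamma> (r b))" "pathin X (\<gamma> (r c))"
          "\<gamma> (r a) 0 = f (r a)" "\<gamma> (r a) 1 = h (r a)" "\<gamma> (r b) 0 = f (r b)"
          "\<gamma> (r b) 1 = h (r b)" "\<gamma> (r c) 0 = f (r c)" "\<gamma> (r c) 1 = h (r c)"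
          using \<gamma>' rX ac le by auto
        have [simp]: "pathin X (subpath_of ?f a b)" "pathin X (subpath_of ?f b c)"
          "pathin X (subpath_of ?h a b)" "pathin X (subpath_of ?h b c)"
          using ac le by (auto intro!: pathin_subpath_of fr hr)
        let ?fab = "subpath_of ?f a b" and ?fbc = "subpath_of ?f b c"
          and ?hab = "subpath_of ?h a b" and ?hbc = "subpath_of ?h b c"
        have "path_homotopic X (path_join (subpath_of ?f a c) (\<gamma> (r c))) (path_join (path_join ?fab ?fbc) (\<gamma> (r c)))"
          using ac le fr by (intro path_homotopic_join path_homotopic_sym[OF path_homotopic_subpath_of_join]) auto
        also have "path_homotopic X \<dots> (path_join ?fab (path_join ?fbc (\<gamma> (r c))))"
          by (intro path_homotopic_assoc) auto
        also have "path_homotopic X \<dots> (path_join ?fab (path_join (\<gamma> (r b)) ?hbc))"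
          by (rule path_homotopic_join) (use Q in \<open>auto simp: Q_def\<close>)
        also have "path_homotopic X \<dots> (path_join (path_join ?fab (\<gamma> (r b))) ?hbc)"
          by (intro path_homotopic_sym[OF path_homotopic_assoc]) auto
        also have "path_homotopic X \<dots> (path_join (path_join (\<gamma> (r a)) ?hab) ?hbc)"
          by (rule path_homotopic_join) (use Q in \<open>auto simp: Q_def\<close>)
        also have "path_homotopic X \<dots> (path_join (\<gamma> (r a)) (path_join ?hab ?hbc))"
          by (intro path_homotopic_assoc) auto
        also have "path_homotopic X \<dots> (path_join (\<gamma> (r a)) (subpath_of ?h a c))"
          using ac le hr by (intro path_homotopic_join path_homotopic_subpath_of_join) auto
        finally show "Q a c" by (simp add: Q_def)
      qed
    next
      fix x :: real assume x: "0 \<le> x" "x \<le> 1"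
      then obtain \<beta> where \<beta>: "\<beta> \<in> I" "r x \<in> B \<beta>"
        using B(2) rX[of x] by auto
      have "openin (top_of_set {0..1}) {t \<in> {0..1}. r t \<in> B \<beta>}"
        using openin_continuous_map_preimage[OF r[unfolded pathin_def] B(1)[OF \<beta>(1)]] by simp
      then obtain d where d: "0 < d" "ball x d \<inter> {0..1} \<subseteq> {t \<in> {0..1}. r t \<in> B \<beta>}"
        using x \<beta> unfolding openin_contains_ball by force
      have "Q a b" if ab: "a \<le> x" "x \<le> b" "b - a < d" "0 \<le> a" "b \<le> 1" for a b
      proof -
        have sub: "r t \<in> B \<beta>" if "t \<in> {a..b}" for t
        proof -
          have "t \<in> ball x d \<inter> {0..1}"
            using that ab by (auto simp: dist_real_def abs_if)
          then show ?thesis using d(2) by blast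
        qed
        have ab': "a \<in> {a..b}" "b \<in> {a..b}" using ab by auto
        then have ra: "r a \<in> topspace X" "r a \<in> B \<beta>" and rb: "r b \<in> topspace X" "r b \<in> B \<beta>"
          using sub rX ab by auto
        \<comment> \<open>Auxiliary joining paths in the single set \<open>V \<beta>\<close>, as
          those of \<gamma> may run elsewhere. With them both ways around the square lie in
          \<open>V \<beta>\<close> and are homotopic; \<open>uniq\<close> then restores
          \<gamma>.\<close>
        obtain ca where ca: "path_from_to X (f (r a)) (h (r a)) ca" "ca ` {0..1} \<subseteq> V \<beta>"
          using join[OF \<beta>(1) ra(2)] by blast
        obtain cb where cb: "path_from_to X (f (r b)) (h (r b)) cb" "cb ` {0..1} \<subseteq> V \<beta>"
          using join[OF \<beta>(1) rb(2)] by blast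
        have [simp]: "pathin X ca" "pathin X cb" "ca 0 = f (r a)" "ca 1 = h (r a)" "cb 0 = f (r b)" "cb 1 = h (r b)"
          using ca cb by (auto simp: path_from_to_def)
        have [simp]: "pathin X (subpath_of ?f a b)" "pathin X (subpath_of ?h a b)"
          using ab by (auto intro!: pathin_subpath_of fr hr)
        have im: "subpath_of ?f a b ` {0..1} \<subseteq> V \<beta>" "subpath_of ?h a b ` {0..1} \<subseteq> V \<beta>"
          by (rule subpath_of_image_subset; use sub V(2)[OF \<beta>(1)] ab in auto)+
        have "path_homotopic X (path_join (subpath_of ?f a b) (\<gamma> (r b))) (path_join (subpath_of ?f a b) cb)"
          by (rule path_homotopic_join) (use uniq[OF rb(1) \<beta>(1) rb(2) cb] \<gamma>'[OF rb(1)] in auto)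
        also have "path_homotopic X \<dots> (path_join ca (subpath_of ?h a b))"
        proof -
          have "pathin X (path_join (subpath_of ?f a b) cb)" "pathin X (path_join ca (subpath_of ?h a b))"
            by (auto intro!: pathin_join)
          moreover have "path_join (subpath_of ?f a b) cb ` {0..1} \<subseteq> V \<beta>"
            "path_join ca (subpath_of ?h a b) ` {0..1} \<subseteq> V \<beta>"
            using im ca cb by (intro path_join_image_subset; simp)+
          ultimately show ?thesis
            using V(1)[OF \<beta>(1)] unfolding path_simple_def by simp
        qed
        also have "path_homotopic X \<dots> (path_join (\<gamma> (r a)) (subpath_of ?h a b))"
          by (rule path_homotopic_join) (use uniq[OF ra(1) \<beta>(1) ra(2) ca] in \<open>auto intro: path_homotopic_sym\<close>)
        finally show ?thesis by (simp add: Q_def)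
      qed
      then show "\<exists>d>0. \<forall>a b. a \<le> x \<and> x \<le> b \<and> b - a < d \<longrightarrow> 0 \<le> a \<and> a \<le> b \<and> b \<le> 1 \<longrightarrow> Q a b"
        using d(1) by blast
    qed simp
    then show ?thesis
      by (simp add: Q_def subpath_of_def)
  qed
  show ?thesis
  proof
    fix \<phi> assume "\<phi> \<in> outer_action X x0 f"
    then obtain p where \<phi>: "\<phi> \<in> auto (fundamental_group X x0)" and p: "path_from_to X x0 (f x0) p"
      and act: "\<And>r. path_from_to X x0 x0 r \<Longrightarrow> \<phi> (loop_class X x0 r) =
          loop_class X x0 (path_join (path_join p (\<lambda>t. f (r t))) (\<lambda>t. p (1 - t)))"
      unfolding outer_action_def by blast
    note p' = p[unfolded path_from_to_def]
    note \<gamma>0 = \<gamma>'[OF x0]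
    let ?q = "path_join p (\<gamma> x0)"
    have q: "path_from_to X x0 (h x0) ?q"
      using p' \<gamma>0 by (auto simp: path_from_to_def intro!: pathin_join)
    have "\<phi> (loop_class X x0 r) = loop_class X x0 (path_join (path_join ?q (\<lambda>t. h (r t))) (\<lambda>t. ?q (1 - t)))"
      if r: "path_from_to X x0 x0 r" for r
    proof -
      have r': "pathin X r" "r 0 = x0" "r 1 = x0"
        using r by (auto simp: path_from_to_def)
      have fr: "pathin X (\<lambda>t. f (r t))" and hr: "pathin X (\<lambda>t. h (r t))"
        using pathin_compose[OF r'(1) f] pathin_compose[OF r'(1) h] by (simp_all add: o_def)
      have H: "path_homotopic X (path_join (path_join p (\<lambda>t. f (r t))) (\<lambda>t. p (1 - t)))
          (path_join (path_join ?q (\<lambda>t. h (r t))) (\<lambda>t. ?q (1 - t)))"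
        using p' \<gamma>0 fr hr r' natural[OF r'(1)] by (intro path_homotopic_transport) auto
      have "loop_class X x0 (path_join (path_join p (\<lambda>t. f (r t))) (\<lambda>t. p (1 - t))) =
          loop_class X x0 (path_join (path_join ?q (\<lambda>t. h (r t))) (\<lambda>t. ?q (1 - t)))"
        using H path_homotopicD[OF H] p' by (subst loop_class_eq_iff) (auto simp: path_from_to_def)
      then show ?thesis using act[OF r] by simp
    qed
    then show "\<phi> \<in> outer_action X x0 h"
      using \<phi> q unfolding outer_action_def by blast
  qed
qed


section \<open>Finiteness\<close>

text \<open>On \<open>A\<close> the map \<open>F\<close> factors through \<tau>, by choice of a
  representative in each fibre.\<close>

lemma finite_image_factor:
  assumes fin: "finite (\<tau> ` A)" and fac: "\<And>x y. x \<in> A \<Longrightarrow> y \<in> A \<Longrightarrow> \<tau> x = \<tau> y \<Longrightarrow> F x = F y"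
  shows "finite (F ` A)"
proof -
  have "F x = F (SOME y. y \<in> A \<and> \<tau> y = \<tau> x)" if x: "x \<in> A" for x
  proof -
    have "(SOME y. y \<in> A \<and> \<tau> y = \<tau> x) \<in> A \<and> \<tau> (SOME y. y \<in> A \<and> \<tau> y = \<tau> x) = \<tau> x"
      by (rule someI[of _ x]) (simp add: x)
    then show ?thesis using fac x by metis
  qed
  then have "F ` A \<subseteq> (\<lambda>t. F (SOME y. y \<in> A \<and> \<tau> y = t)) ` \<tau> ` A"
    by blast
  then show ?thesis using fin by (rule finite_subset[OF _ finite_imageI])
qed

context closed_riemannian
begin

lemma finite_outer_action_isometric:
  assumes x0: "x0 \<in> topspace X"
  shows "finite (outer_action X x0 ` {f. isometric f})"
proof -
  obtain P where P: "finite P" "\<And>b. b \<in> P \<Longrightarrow> is_box M b" "topspace X \<subseteq> (\<Union>b\<in>P. inner_box M b)"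
    and star: "\<And>b b'. b \<in> P \<Longrightarrow> b' \<in> P \<Longrightarrow> outer_box M b \<inter> outer_box M b' \<noteq> {} \<Longrightarrow>
        \<exists>D. path_simple X D \<and> outer_box M b \<union> outer_box M b' \<subseteq> D"
    using ex_barycentric_box_cover by meson
  \<comment> \<open>Quantifying over all isometries inside the definition makes the finite subcover
    independent of \<open>f\<close>.\<close>
  define \<U> where "\<U> = {B. openin X B \<and> (\<forall>f. isometric f \<longrightarrow> (\<exists>b\<in>P. f ` B \<subseteq> outer_box M b))}"
  have "topspace X \<subseteq> \<Union>\<U>"
    using isometries_equicontinuous[OF P] unfolding \<U>_def by blast
  moreover have "\<forall>B\<in>\<U>. openin X B"
    by (simp add: \<U>_def)
  ultimately obtain \<B> where \<B>: "finite \<B>" "\<B> \<subseteq> \<U>" "topspace X \<subseteq> \<Union>\<B>"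
    using compact[unfolded compact_space_alt] by meson
  \<comment> \<open>The combinatorial type of \<open>f\<close>. Restricting it to
    \<open>\<B>\<close> places it in a finite product of copies of \<open>P\<close>.\<close>
  define \<tau> where "\<tau> f = (\<lambda>B\<in>\<B>. SOME b. b \<in> P \<and> f ` B \<subseteq> outer_box M b)" for f
  have \<tau>: "\<tau> f B \<in> P \<and> f ` B \<subseteq> outer_box M (\<tau> f B)" if "isometric f" "B \<in> \<B>" for f B
  proof -
    have "\<exists>b. b \<in> P \<and> f ` B \<subseteq> outer_box M b"
      using that \<B>(2) unfolding \<U>_def by blast
    from someI_ex[OF this] show ?thesis
      using that(2) by (simp add: \<tau>_def)
  qed
  have "\<tau> ` {f. isometric f} \<subseteq> PiE \<B> (\<lambda>_. P)"
  proof (intro image_subsetI PiE_I)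
    fix f B assume "f \<in> {f. isometric f}" "B \<in> \<B>"
    then show "\<tau> f B \<in> P" using \<tau> by blast
  qed (simp add: \<tau>_def)
  then have fin: "finite (\<tau> ` {f. isometric f})"
    by (rule finite_subset) (simp add: finite_PiE \<B>(1) P(1))
  have close: "outer_action X x0 f \<subseteq> outer_action X x0 h"
    if f: "isometric f" and h: "isometric h" and eq: "\<tau> f = \<tau> h" for f h
  proof (rule outer_action_subset_of_close[where I = \<B> and B = "\<lambda>B. B" and V = "\<lambda>B. outer_box M (\<tau> f B)"])
    show "f x \<in> outer_box M (\<tau> f \<beta>) \<and> h x \<in> outer_box M (\<tau> f \<beta>)" if "\<beta> \<in> \<B>" "x \<in> \<beta>" for \<beta> x
      using \<tau>[OF f that(1)] \<tau>[OF h that(1)] that(2) eq by auto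
    show "path_simple X (outer_box M (\<tau> f \<beta>))" if "\<beta> \<in> \<B>" for \<beta>
      using \<tau>[OF f that] P(2) path_simple_outer_box by blast
    show "\<exists>D. path_simple X D \<and> outer_box M (\<tau> f \<beta>) \<union> outer_box M (\<tau> f \<beta>') \<subseteq> D"
      if "\<beta> \<in> \<B>" "\<beta>' \<in> \<B>" "outer_box M (\<tau> f \<beta>) \<inter> outer_box M (\<tau> f \<beta>') \<noteq> {}" for \<beta> \<beta>'
      using star[OF _ _ that(3)] \<tau>[OF f that(1)] \<tau>[OF f that(2)] by blast
    show "openin X \<beta>" if "\<beta> \<in> \<B>" for \<beta>
      using that \<B>(2) by (auto simp: \<U>_def)
    show "topspace X \<subseteq> (\<Union>\<beta>\<in>\<B>. \<beta>)"
      using \<B>(3) by simp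
  qed (use x0 continuous_map_isometric f h in auto)
  \<comment> \<open>Maps of equal type enter \<open>close\<close> symmetrically, so the inclusion
    holds both ways.\<close>
  show ?thesis
    using fin by (rule finite_image_factor) (simp add: close subset_antisym)
qed

end

theorem theorem5:
  fixes M :: "('w \<times> 'a) set set mfd" and x0 :: "('w \<times> 'a) set set"
  assumes "piecewise_locally_symmetric M"
    and "closed_manifold M"
    and "3 \<le> mdim M"
    and "x0 \<in> topspace (mtop M)"
    and "infinite (carrier (Out (fundamental_group (mtop M) x0)))"
  shows "\<not> (\<exists>g \<rho>. riemannian_metric M g \<and>
               \<rho> \<in> hom (Out (fundamental_group (mtop M) x0)) (isometry_group M g) \<and>
               (\<forall>\<phi> \<in> carrier (Out (fundamental_group (mtop M) x0)).
                  outer_action (mtop M) x0 (\<rho> \<phi>) = \<phi>))"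
proof (intro notI, elim exE conjE)
  fix g \<rho>
  assume g: "riemannian_metric M g"
    and \<rho>: "\<rho> \<in> hom (Out (fundamental_group (mtop M) x0)) (isometry_group M g)"
    and sec: "\<forall>\<phi> \<in> carrier (Out (fundamental_group (mtop M) x0)). outer_action (mtop M) x0 (\<rho> \<phi>) = \<phi>"
  interpret closed_riemannian M g
    using assms(2) g by unfold_locales (auto simp: closed_manifold_def)
  have "\<phi> \<in> outer_action X x0 ` {f. isometric f}"
    if \<phi>: "\<phi> \<in> carrier (Out (fundamental_group X x0))" for \<phi>
  proof (rule image_eqI)
    show "\<phi> = outer_action X x0 (\<rho> \<phi>)"
      using sec \<phi> by simp
    show "\<rho> \<phi> \<in> {f. isometric f}"
      using hom_in_carrier[OF \<rho> \<phi>]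
      by (simp add: isometry_group_def isometric_def diffeomorphism_def)
  qed
  then have "carrier (Out (fundamental_group X x0)) \<subseteq> outer_action X x0 ` {f. isometric f}"
    by blast
  then show False
    using assms(5) finite_subset[OF _ finite_outer_action_isometric[OF assms(4)]] by blast
qed

end
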